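(* Let $(\sigma_n)_{n=1}^\infty$ be an increasing sequence of positive integers with $\sigma_{n+1}-\sigma_n\ge n$ for all $n\ge1$ and such that the limit \[\beta:=\lim_{n\to\infty}\frac{\sigma_{n+1}-\sigma_n}{n}\] exists in $[1,\infty]$. Define \[G((\sigma_n)_{n=1}^\infty)=\{x\in J\colon a_{\sigma_n}(x),\ldots,a_{\sigma_n+n-1}(x)\ \text{is an arithmetic progression for all sufficiently large}\ n\}.\] Then \[\dim_{\rm H} G((\sigma_n)_{n=1}^\infty)=\begin{cases}\dfrac{\beta-1}{2\beta}&\text{if }\beta<\infty,\\ 1/2&\text{otherwise.}\end{cases}\]
   Context: Every irrational $x\in(0,1)$ has a regular continued fraction expansion $x=\cfrac{1}{a_1(x)+\cfrac{1}{a_2(x)+\cdots}}$ with partial quotients $a_n(x)\in\mathbb N$. $J=\{x\in(0,1)\setminus\mathbb Q\colon a_n(x)<a_{n+1}(x)\text{ for every }n\ge1\}$. $\dim_{\rm H}$ denotes Hausdorff dimension in $[0,1]$ with the Euclidean metric. *)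

theory Defs
  imports "HOL-Analysis.Analysis"
begin

definition gauss_map :: "real \<Rightarrow> real" where
  "gauss_map x = frac (1 / x)"

text \<open>Partial quotients a_n(x), n \<ge> 1: a_n(x) = floor(1 / T^(n-1)(x)).
  (The value for n = 0 is irrelevant and never used.)\<close>
definition cf_a :: "nat \<Rightarrow> real \<Rightarrow> nat" where
  "cf_a n x = nat \<lfloor>1 / ((gauss_map ^^ (n - 1)) x)\<rfloor>"

definition J_set :: "real set" where
  "J_set = {x. 0 < x \<and> x < 1 \<and> x \<notin> \<rat> \<and> (\<forall>n\<ge>1. cf_a n x < cf_a (Suc n) x)}"

definition cf_block_AP :: "real \<Rightarrow> nat \<Rightarrow> nat \<Rightarrow> bool" where
  "cf_block_AP x m n \<longleftrightarrow>
     (\<forall>i. i + 1 < n \<longrightarrow>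
        int (cf_a (m + i + 1) x) - int (cf_a (m + i) x) = int (cf_a (m + 1) x) - int (cf_a m x))"

definition G_set :: "(nat \<Rightarrow> nat) \<Rightarrow> real set" where
  "G_set \<sigma> = {x \<in> J_set. \<exists>N. \<forall>n\<ge>N. cf_block_AP x (\<sigma> n) n}"

text \<open>diam(U)^s with the usual conventions: the empty set contributes 0 and
  0^0 = 1 (so H^0 is the counting measure).\<close>
definition diam_pow :: "real \<Rightarrow> real set \<Rightarrow> real" where
  "diam_pow s U = (if U = {} then 0
                   else if diameter U = 0 then (if s = 0 then 1 else 0)
                   else diameter U powr s)"

definition hausdorff_content :: "real \<Rightarrow> real \<Rightarrow> real set \<Rightarrow> ennreal" where
  "hausdorff_content \<delta> s E =
     (INF U \<in> {U :: nat \<Rightarrow> real set. E \<subseteq> (\<Union>i. U i) \<and> (\<forall>i. bounded (U i) \<and> diameter (U i) \<le> \<delta>)}.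
        (\<Sum>i. ennreal (diam_pow s (U i))))"

definition hausdorff_measure :: "real \<Rightarrow> real set \<Rightarrow> ennreal" where
  "hausdorff_measure s E = (SUP \<delta> \<in> {0<..}. hausdorff_content \<delta> s E)"

definition hausdorff_dim :: "real set \<Rightarrow> real" where
  "hausdorff_dim E = Inf {s. s \<ge> 0 \<and> hausdorff_measure s E = 0}"

end

theory Submission
  imports Defs "HOL-Real_Asymp.Real_Asymp"
begin

text \<open>
  Upper bound. On digits \<open>a\<^sub>1, \<dots>, a\<^sub>n\<close> the inverse branch of the Gauss map contracts distances by at least the factor
  \<open>\<Prod> 1 / a\<^sub>i\<^sup>2\<close>. Since the digits increase, every digit of a progression dominates all free digits
  before it, so the \<open>n\<close> progression digits can be traded against the roughly \<open>(\<beta> - 1) n\<close>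
  preceding free ones: each free digit \<open>f\<close> then carries a weight about
  \<open>f powr (- 2 s \<beta> / (\<beta> - 1))\<close>, which is summable when \<open>s > (\<beta> - 1) / (2 \<beta>)\<close>. The two
  parameters of a progression cost only boundedly many of its digits.

  Lower bound. Let the free digit at position \<open>i\<close> range over an interval of \<open>i ^ (L - 1)\<close> integers
  above \<open>i ^ L\<close> and fix all progressions. Reading the free digits as mixed radix digits maps
  \<open>[0, 1)\<close> into this set by a map whose inverse is \<open>s\<close>-Hoelder for every
  \<open>s < (1 - 1 / L) (\<beta> - 1) / (2 \<beta>)\<close>, so the set has positive \<open>s\<close>-dimensional measure.
\<close>

section \<open>The Gauss map\<close>

definition irr01 :: "real set" where
  "irr01 = {x. 0 < x \<and> x < 1 \<and> x \<notin> \<rat>}"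

lemma gauss_map_irr01:
  assumes "x \<in> irr01" shows "gauss_map x \<in> irr01"
proof -
  have irr: "1 / x \<notin> \<rat>"
  proof
    assume "1 / x \<in> \<rat>"
    then have "1 / (1 / x) \<in> \<rat>" by (rule Rats_divide[OF Rats_1])
    with assms show False by (simp add: irr01_def)
  qed
  have "frac (1 / x) \<notin> \<rat>"
  proof
    assume "frac (1 / x) \<in> \<rat>"
    then have "frac (1 / x) + of_int \<lfloor>1 / x\<rfloor> \<in> \<rat>" by (intro Rats_add) auto
    with irr show False by (simp add: frac_def)
  qed
  moreover from this have "frac (1 / x) \<noteq> 0" by (metis Rats_0)
  ultimately show ?thesis
    using frac_ge_0[of "1 / x"] frac_lt_1[of "1 / x"]
    unfolding irr01_def gauss_map_def by auto
qed

lemma gauss_map_funpow_irr01: "x \<in> irr01 \<Longrightarrow> (gauss_map ^^ n) x \<in> irr01"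
  by (induction n) (auto simp: gauss_map_irr01)

lemma cf_a_Suc_shift: "cf_a (Suc (Suc n)) x = cf_a (Suc n) (gauss_map x)"
  unfolding cf_a_def by (simp del: funpow.simps add: funpow_Suc_right)

lemma cf_a_shift: "n \<ge> 1 \<Longrightarrow> cf_a (n + m) x = cf_a n ((gauss_map ^^ m) x)"
  unfolding cf_a_def by (simp add: funpow_add[symmetric, THEN fun_cong, simplified])

lemma cf_a_first_ge: "x \<in> irr01 \<Longrightarrow> 1 \<le> cf_a (Suc 0) x"
  unfolding cf_a_def irr01_def by (simp add: nat_le_iff le_nat_iff le_floor_iff)

lemma cf_expand:
  assumes "x \<in> irr01" shows "x = 1 / (real (cf_a (Suc 0) x) + gauss_map x)"
proof -
  have "real (cf_a (Suc 0) x) = of_int \<lfloor>1 / x\<rfloor>"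
    using assms unfolding cf_a_def irr01_def by simp
  then have "real (cf_a (Suc 0) x) + gauss_map x = 1 / x"
    by (simp add: gauss_map_def frac_def)
  then show ?thesis by simp
qed

lemma J_set_alt: "J_set = {x \<in> irr01. \<forall>n\<ge>1. cf_a n x < cf_a (Suc n) x}"
  by (auto simp: J_set_def irr01_def)

lemma J_set_gauss_map: "x \<in> J_set \<Longrightarrow> gauss_map x \<in> J_set"
  using cf_a_shift[of _ 1 x] unfolding J_set_alt
  by (simp add: gauss_map_irr01) (metis add_Suc le_SucI)

text \<open>Used to push digits past any threshold by dropping a prefix, and to make every digit
  after the first at least 2.\<close>

lemma J_set_digit_ge:
  assumes "x \<in> J_set" "n \<ge> 1" shows "n \<le> cf_a n x"
  using assms(2)
proof (induction n rule: dec_induct)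
  case base
  show ?case using assms cf_a_first_ge by (auto simp: J_set_alt)
next
  case (step n)
  then have "cf_a n x < cf_a (Suc n) x" using assms by (auto simp: J_set_alt)
  with step show ?case by linarith
qed

section \<open>Covering content\<close>

text \<open>Hausdorff content without a bound on the diameters. For \<open>s > 0\<close> its null
  sets are null for the Hausdorff measure, and it passes easily through inverse branches. Points and
  empty sets cost nothing since \<open>0 powr s = 0\<close>.\<close>

definition cov_content:: "real \<Rightarrow> real set \<Rightarrow> ennreal" where
  "cov_content s E =
     (INF U \<in> {U :: nat \<Rightarrow> real set. E \<subseteq> (\<Union>i. U i) \<and> (\<forall>i. bounded (U i))}.
        (\<Sum>i. ennreal (diameter (U i) powr s)))"

lemma diam_pow_eq: "s > 0 \<Longrightarrow> diam_pow s U = diameter U powr s"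
  by (auto simp: diam_pow_def)

lemma cov_content_le:
  assumes "E \<subseteq> (\<Union>i. U i)" "\<And>i. bounded (U i)"
  shows "cov_content s E \<le> (\<Sum>i::nat. ennreal (diameter (U i) powr s))"
  unfolding cov_content_def using assms by (intro INF_lower) auto

lemma cov_content_less:
  assumes "cov_content s E < r"
  shows "\<exists>U. E \<subseteq> (\<Union>i. U i) \<and> (\<forall>i::nat. bounded (U i)) \<and>
    (\<Sum>i. ennreal (diameter (U i) powr s)) < r"
  using assms unfolding cov_content_def INF_less_iff by auto

lemma cov_content_mono: "E \<subseteq> F \<Longrightarrow> cov_content s E \<le> cov_content s F"
  unfolding cov_content_def by (intro INF_superset_mono) auto

lemma cov_content_null_subset: "cov_content s F = 0 \<Longrightarrow> E \<subseteq> F \<Longrightarrow> cov_content s E = 0"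
  using cov_content_mono[of E F s] by simp

lemma cov_content_unit:
  assumes "s > 0" shows "cov_content s {0..1} \<le> 1"
proof -
  have "cov_content s {0..1} \<le> (\<Sum>i::nat. ennreal (diameter (if i = 0 then {0..1::real} else {}) powr s))"
    by (intro cov_content_le) (auto split: if_splits)
  also have "\<dots> = (\<Sum>i\<in>{0::nat}. ennreal (diameter (if i = 0 then {0..1::real} else {}) powr s))"
    by (intro suminf_finite) auto
  also have "\<dots> = 1" by simp
  finally show ?thesis .
qed

text \<open>Covers of \<open>E k\<close> with excess \<open>e / 2 ^ (k + 1)\<close> are merged into
  one sequence by \<open>prod_decode\<close>.\<close>

lemma cov_content_UN: "cov_content s (\<Union>k. E k) \<le> (\<Sum>k::nat. cov_content s (E k))"
proof (cases "(\<Sum>k. cov_content s (E k)) = top")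
  case False
  then have fin: "cov_content s (E k) < top" for k
    by (metis ennreal_suminf_lessD top.not_eq_extremum)
  show ?thesis
  proof (rule ennreal_le_epsilon)
    fix e :: real assume e: "e > 0"
    have "\<exists>U. E k \<subseteq> (\<Union>i. U i) \<and> (\<forall>i::nat. bounded (U i)) \<and>
        (\<Sum>i. ennreal (diameter (U i) powr s)) < cov_content s (E k) + ennreal (e * (1/2) ^ Suc k)" for k
      using e fin[of k] by (intro cov_content_less, cases "cov_content s (E k)")
        (simp_all flip: ennreal_plus add: ennreal_less_iff)
    then obtain U where U: "\<And>k. E k \<subseteq> (\<Union>i. U k i)" "\<And>k i::nat. bounded (U k i)"
        "\<And>k. (\<Sum>i. ennreal (diameter (U k i) powr s)) < cov_content s (E k) + ennreal (e * (1/2) ^ Suc k)"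
      by metis
    have "cov_content s (\<Union>k. E k) \<le> (\<Sum>j. ennreal (diameter (case_prod U (prod_decode j)) powr s))"
    proof (rule cov_content_le)
      show "(\<Union>k. E k) \<subseteq> (\<Union>j. case_prod U (prod_decode j))"
      proof
        fix x assume "x \<in> (\<Union>k. E k)"
        then obtain k where "x \<in> E k" by blast
        then obtain i where "x \<in> U k i" using U(1)[of k] by blast
        then have "x \<in> case_prod U (prod_decode (prod_encode (k, i)))" by simp
        then show "x \<in> (\<Union>j. case_prod U (prod_decode j))" by (rule UN_I[OF UNIV_I])
      qed
      show "bounded (case_prod U (prod_decode j))" for j by (simp add: U(2) case_prod_unfold)
    qed
    also have "\<dots> = (\<Sum>k. \<Sum>i. ennreal (diameter (U k i) powr s))"
      by (rule suminf_ennreal_2dimen[where f = "\<lambda>p. ennreal (diameter (case_prod U p) powr s)"]) simp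
    also have "\<dots> \<le> (\<Sum>k. cov_content s (E k) + ennreal (e * (1/2) ^ Suc k))"
      by (intro suminf_le less_imp_le U(3)) auto
    also have "\<dots> = (\<Sum>k. cov_content s (E k)) + (\<Sum>k. ennreal (e * (1/2) ^ Suc k))"
      by (intro suminf_add[symmetric]) auto
    also have "(\<Sum>k. ennreal (e * (1/2) ^ Suc k)) = ennreal e"
      using e sums_mult[OF power_half_series, of e]
      by (intro suminf_ennreal_eq) auto
    finally show "cov_content s (\<Union>k. E k) \<le> (\<Sum>k. cov_content s (E k)) + ennreal e" .
  qed
qed simp

lemma cov_content_UN_null:
  assumes "\<And>k::nat. cov_content s (E k) = 0" shows "cov_content s (\<Union>k. E k) = 0"
  using cov_content_UN[of s E] assms by simp

text \<open>For \<open>s > 0\<close> a cover of small total weight automatically has small diameters, so the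
  mesh restriction in the Hausdorff measure is irrelevant for null sets.\<close>
lemma hausdorff_measure_null:
  assumes s: "s > 0" and null: "cov_content s E = 0"
  shows "hausdorff_measure s E = 0"
proof -
  have main: "hausdorff_content \<delta> s E \<le> ennreal e" if \<delta>: "\<delta> > 0" and e: "e > 0" for \<delta> e
  proof -
    have "cov_content s E < ennreal (min e (\<delta> powr s))" using null \<delta> e by simp
    then obtain U where U: "E \<subseteq> (\<Union>i. U i)" "\<And>i::nat. bounded (U i)"
        "(\<Sum>i. ennreal (diameter (U i) powr s)) < ennreal (min e (\<delta> powr s))"
      using cov_content_less[of s E] by blast
    have "diameter (U i) \<le> \<delta>" for i
    proof -
      have "ennreal (diameter (U i) powr s) < ennreal (min e (\<delta> powr s))"
        using U(3) by (rule ennreal_suminf_lessD)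
      then have "diameter (U i) powr s < \<delta> powr s" using \<delta> e by (simp add: ennreal_less_iff)
      moreover have "\<delta> powr s \<le> diameter (U i) powr s" if "\<delta> \<le> diameter (U i)"
        using s \<delta> that by (intro powr_mono2) auto
      ultimately show ?thesis by linarith
    qed
    then have "hausdorff_content \<delta> s E \<le> (\<Sum>i. ennreal (diam_pow s (U i)))"
      unfolding hausdorff_content_def using U by (intro INF_lower) auto
    also have "\<dots> = (\<Sum>i. ennreal (diameter (U i) powr s))" by (simp add: diam_pow_eq s)
    also have "\<dots> \<le> ennreal (min e (\<delta> powr s))" using U(3) by (rule less_imp_le)
    also have "\<dots> \<le> ennreal e" by (intro ennreal_leI) simp
    finally show ?thesis .
  qed
  then have "hausdorff_content \<delta> s E = 0" if "\<delta> > 0" for \<delta>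
  proof -
    have "hausdorff_content \<delta> s E \<le> 0"
      by (rule ennreal_le_epsilon) (simp add: main that)
    then show ?thesis by simp
  qed
  then have "hausdorff_measure s E \<le> 0"
    unfolding hausdorff_measure_def by (intro SUP_least) auto
  then show ?thesis by simp
qed

section \<open>Covering content under inverse branches of the Gauss map\<close>

lemma inverse_branch_dist:
  fixes a t u :: real
  assumes "a \<ge> 1" "t \<ge> 0" "u \<ge> 0"
  shows "\<bar>1 / (a + t) - 1 / (a + u)\<bar> = \<bar>t - u\<bar> / ((a + t) * (a + u))"
proof -
  have "1 / (a + t) - 1 / (a + u) = (u - t) / ((a + t) * (a + u))"
    using assms by (simp add: field_simps)
  then show ?thesis using assms by (simp add: abs_mult abs_minus_commute)
qed

text \<open>The inverse branch sending \<open>t\<close> to \<open>1 / (a + t)\<close> contracts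
  \<open>[0, 1]\<close> by at least \<open>a ^ 2\<close>, so the images of a cover of
  \<open>E\<close> cover the cylinder at correspondingly smaller cost.\<close>

lemma cov_content_branch:
  assumes a: "a \<ge> 1" and s: "s > 0"
  shows "cov_content s {x \<in> irr01. cf_a (Suc 0) x = a \<and> gauss_map x \<in> E}
    \<le> ennreal (real a powr (- 2 * s)) * cov_content s E"
    (is "cov_content s ?F \<le> _")
proof -
  define c where "c = real a powr (2 * s)"
  have c: "c > 0" using a by (simp add: c_def)
  have cinv: "real a powr (- 2 * s) = 1 / c"
    by (simp add: c_def powr_minus_divide)
  \<comment> \<open>The constant stands on the left so that the right side is a bare infimum over
    covers of \<open>E\<close>; multiplying by \<open>1 / c\<close> at the end moves it
    back.\<close>
  have "ennreal c * cov_content s ?F \<le> cov_content s E"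
    unfolding cov_content_def[of s E]
  proof (rule INF_greatest)
    fix U :: "nat \<Rightarrow> real set"
    assume "U \<in> {U. E \<subseteq> (\<Union>i. U i) \<and> (\<forall>i. bounded (U i))}"
    then have U: "E \<subseteq> (\<Union>i. U i)" "\<And>i. bounded (U i)" by auto
    \<comment> \<open>Cutting with \<open>{0..1}\<close> keeps \<open>t\<close> nonnegative, as the
      contraction bound requires; nothing is lost because \<open>gauss_map\<close> takes its values
      there.\<close>
    define V where "V i = (\<lambda>t. 1 / (real a + t)) ` (U i \<inter> {0..1})" for i
    have dist: "\<bar>x - y\<bar> \<le> diameter (U i) / (real a)\<^sup>2" if xy: "x \<in> V i" "y \<in> V i" for x y i
    proof -
      obtain t u where tu: "t \<in> U i" "u \<in> U i" "0 \<le> t" "0 \<le> u"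
        "x = 1 / (real a + t)" "y = 1 / (real a + u)"
        using xy by (auto simp: V_def)
      have "\<bar>t - u\<bar> \<le> diameter (U i)"
        using diameter_bounded_bound[OF U(2)[of i] tu(1,2)] by (simp add: dist_real_def)
      moreover have "(real a)\<^sup>2 \<le> (real a + t) * (real a + u)"
        unfolding power2_eq_square using tu by (intro mult_mono) auto
      ultimately have "\<bar>t - u\<bar> / ((real a + t) * (real a + u)) \<le> diameter (U i) / (real a)\<^sup>2"
        using a by (intro frac_le) auto
      then show ?thesis using inverse_branch_dist[of a t u] tu a by simp
    qed
    have bV: "bounded (V i)" for i
      by (rule bounded_subset[of "{0..1}"]) (use a in \<open>auto simp: V_def divide_simps\<close>)
    have dV: "diameter (V i) powr s \<le> diameter (U i) powr s / c" for i
    proof -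
      have "diameter (V i) \<le> diameter (U i) / (real a)\<^sup>2"
        using dist diameter_ge_0[OF U(2)] by (intro diameter_le) auto
      then have "diameter (V i) powr s \<le> (diameter (U i) / (real a)\<^sup>2) powr s"
        using s diameter_ge_0[OF bV] by (intro powr_mono2) auto
      also have "\<dots> = diameter (U i) powr s / ((real a)\<^sup>2) powr s"
        using diameter_ge_0[OF U(2)] by (simp add: powr_divide)
      also have "((real a)\<^sup>2) powr s = c"
        using a by (simp add: c_def powr_powr flip: powr_numeral)
      finally show ?thesis .
    qed
    have "cov_content s ?F \<le> (\<Sum>i. ennreal (diameter (V i) powr s))"
    proof (rule cov_content_le[OF _ bV])
      show "?F \<subseteq> (\<Union>i. V i)"
      proof
        fix x assume x: "x \<in> ?F"
        then obtain i where "gauss_map x \<in> U i" using U(1) by auto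
        moreover have "gauss_map x \<in> {0..1}"
          using x gauss_map_irr01[of x] by (auto simp: irr01_def)
        moreover have "x = 1 / (real a + gauss_map x)" using x cf_expand[of x] by auto
        ultimately have "x \<in> V i" unfolding V_def by blast
        then show "x \<in> (\<Union>i. V i)" by blast
      qed
    qed
    also have "\<dots> \<le> (\<Sum>i. ennreal (1 / c) * ennreal (diameter (U i) powr s))"
      using dV c by (intro suminf_le) (auto simp flip: ennreal_mult intro!: ennreal_leI)
    also have "\<dots> = ennreal (1 / c) * (\<Sum>i. ennreal (diameter (U i) powr s))" by simp
    finally have "ennreal c * cov_content s ?F
        \<le> ennreal c * (ennreal (1 / c) * (\<Sum>i. ennreal (diameter (U i) powr s)))"
      by (rule mult_left_mono) simp
    also have "\<dots> = (\<Sum>i. ennreal (diameter (U i) powr s))"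
      using c by (simp flip: ennreal_mult mult.assoc)
    finally show "ennreal c * cov_content s ?F \<le> (\<Sum>i. ennreal (diameter (U i) powr s))" .
  qed
  then have "ennreal (1 / c) * (ennreal c * cov_content s ?F) \<le> ennreal (1 / c) * cov_content s E"
    by (rule mult_left_mono) simp
  then show ?thesis using c unfolding cinv by (simp flip: ennreal_mult mult.assoc)
qed

lemma cov_content_prefix:
  assumes s: "s > 0" and a: "\<And>i. i < n \<Longrightarrow> a i \<ge> 1"
  shows "cov_content s {x \<in> irr01. (\<forall>i<n. cf_a (Suc i) x = a i) \<and> (gauss_map ^^ n) x \<in> E}
    \<le> ennreal (\<Prod>i<n. real (a i) powr (- 2 * s)) * cov_content s E"
  using a
proof (induction n arbitrary: a)
  case 0
  then show ?case by (auto intro: cov_content_mono)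
next
  case (Suc n)
  let ?F = "{x \<in> irr01. (\<forall>i<n. cf_a (Suc i) x = a (Suc i)) \<and> (gauss_map ^^ n) x \<in> E}"
  have "cov_content s {x \<in> irr01. (\<forall>i<Suc n. cf_a (Suc i) x = a i) \<and> (gauss_map ^^ Suc n) x \<in> E}
      \<le> cov_content s {x \<in> irr01. cf_a (Suc 0) x = a 0 \<and> gauss_map x \<in> ?F}"
    by (intro cov_content_mono)
       (auto simp: gauss_map_irr01 funpow_swap1 simp flip: cf_a_Suc_shift)
  also have "\<dots> \<le> ennreal (real (a 0) powr (- 2 * s)) * cov_content s ?F"
    using Suc.prems s by (intro cov_content_branch) auto
  also have "\<dots> \<le> ennreal (real (a 0) powr (- 2 * s)) *
      (ennreal (\<Prod>i<n. real (a (Suc i)) powr (- 2 * s)) * cov_content s E)"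
    using Suc.prems by (intro mult_left_mono Suc.IH) auto
  also have "\<dots> = ennreal (\<Prod>i<Suc n. real (a i) powr (- 2 * s)) * cov_content s E"
    unfolding prod.lessThan_Suc_shift
    by (simp add: ennreal_mult prod_nonneg mult.assoc)
  finally show ?case .
qed

text \<open>There are countably many branches and each maps null sets to null sets. Hence finitely
  many initial digits can be ignored when proving a set null.\<close>

lemma cov_content_gauss_preimage_null:
  assumes s: "s > 0" and "cov_content s E = 0"
  shows "cov_content s {x \<in> irr01. (gauss_map ^^ n) x \<in> E} = 0"
  using assms(2)
proof (induction n arbitrary: E)
  case 0
  then show ?case using cov_content_mono[of "{x \<in> irr01. x \<in> E}" E s] by auto
next
  case (Suc n)
  have "cov_content s {x \<in> irr01. cf_a (Suc 0) x = Suc k \<and> gauss_map x \<in> E} = 0" for k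
    using cov_content_branch[of "Suc k" s E] Suc.prems s by simp
  then have "cov_content s (\<Union>k. {x \<in> irr01. cf_a (Suc 0) x = Suc k \<and> gauss_map x \<in> E}) = 0"
    by (rule cov_content_UN_null)
  moreover have "{x \<in> irr01. gauss_map x \<in> E} \<subseteq>
      (\<Union>k. {x \<in> irr01. cf_a (Suc 0) x = Suc k \<and> gauss_map x \<in> E})"
    using cf_a_first_ge by (auto simp: Suc_le_eq gr0_conv_Suc)
  ultimately have "cov_content s {x \<in> irr01. gauss_map x \<in> E} = 0"
    by (rule cov_content_null_subset)
  from Suc.IH[OF this] show ?case
    by (rule cov_content_null_subset) (auto simp: gauss_map_funpow_irr01)
qed

section \<open>The upper bound\<close>

lemma J_set_funpow: "x \<in> J_set \<Longrightarrow> (gauss_map ^^ n) x \<in> J_set"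
  by (induction n) (auto simp: J_set_gauss_map)

lemma cf_block_AP_shift:
  assumes "k \<ge> 1"
  shows "cf_block_AP ((gauss_map ^^ m) x) k n \<longleftrightarrow> cf_block_AP x (k + m) n"
proof -
  have "cf_a j ((gauss_map ^^ m) x) = cf_a (j + m) x" if "j \<ge> 1" for j
    using cf_a_shift[OF that] by simp
  then show ?thesis using assms unfolding cf_block_AP_def by (simp add: ac_simps)
qed

text \<open>The possible values of the \<open>m\<close>-th Gauss iterate of a point of \<open>G_set \<sigma>\<close> whose
  progressions start at index \<open>N\<close> and whose next digit exceeds \<open>b\<close>.\<close>
definition tail_set :: "(nat \<Rightarrow> nat) \<Rightarrow> nat \<Rightarrow> nat \<Rightarrow> nat \<Rightarrow> real set" where
  "tail_set \<sigma> N m b = {t \<in> J_set. b < cf_a (Suc 0) t \<and>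
     (\<forall>n\<ge>N. m < \<sigma> n \<longrightarrow> cf_block_AP t (\<sigma> n - m) n)}"

lemma tail_set_antimono: "b \<le> b' \<Longrightarrow> tail_set \<sigma> N m b' \<subseteq> tail_set \<sigma> N m b"
  by (auto simp: tail_set_def)

lemma tail_set_subset_irr01: "tail_set \<sigma> N m b \<subseteq> irr01"
  by (auto simp: tail_set_def J_set_alt)

lemma cov_content_tail_set_le_1: "s > 0 \<Longrightarrow> cov_content s (tail_set \<sigma> N m b) \<le> 1"
  using cov_content_mono[of "tail_set \<sigma> N m b" "{0..1}" s] tail_set_subset_irr01[of \<sigma> N m b]
    cov_content_unit[of s]
  by (fastforce simp: irr01_def)

lemma tail_set_step:
  assumes "t \<in> tail_set \<sigma> N m b"
  shows "gauss_map t \<in> tail_set \<sigma> N (Suc m) (cf_a (Suc 0) t)"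
proof -
  have J: "t \<in> J_set" using assms by (simp add: tail_set_def)
  have "cf_a (Suc 0) t < cf_a (Suc 0) (gauss_map t)"
    using J by (simp add: J_set_alt flip: cf_a_Suc_shift)
  moreover have "cf_block_AP (gauss_map t) (\<sigma> n - Suc m) n" if "n \<ge> N" "Suc m < \<sigma> n" for n
    using assms that cf_block_AP_shift[of "\<sigma> n - Suc m" 1 t n]
    by (auto simp: tail_set_def Suc_diff_Suc)
  ultimately show ?thesis using J by (simp add: tail_set_def J_set_gauss_map)
qed

lemma tail_set_funpow:
  assumes "t \<in> tail_set \<sigma> N m b"
  shows "(gauss_map ^^ n) t \<in> tail_set \<sigma> N (m + n) b"
proof (induction n)
  case (Suc n)
  have "b \<le> cf_a (Suc 0) ((gauss_map ^^ n) t)" using Suc by (simp add: tail_set_def)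
  then show ?case using tail_set_step[OF Suc] tail_set_antimono by fastforce
qed (use assms in simp)

text \<open>Split by the first digit \<open>b + 1 + k\<close>. Because digits increase, this digit
  becomes the new lower bound, which is what lets later weights be traded against it.\<close>

lemma cov_content_tail_set_step:
  assumes s: "s > 0"
  shows "cov_content s (tail_set \<sigma> N m b) \<le>
    (\<Sum>k. ennreal (real (b + 1 + k) powr (- 2 * s)) * cov_content s (tail_set \<sigma> N (Suc m) (b + 1 + k)))"
proof -
  let ?F = "\<lambda>k. {x \<in> irr01. cf_a (Suc 0) x = b + 1 + k \<and> gauss_map x \<in> tail_set \<sigma> N (Suc m) (b + 1 + k)}"
  have "tail_set \<sigma> N m b \<subseteq> (\<Union>k. ?F k)"
  proof
    fix t assume t: "t \<in> tail_set \<sigma> N m b"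
    then have "b < cf_a (Suc 0) t" by (simp add: tail_set_def)
    then obtain k where "cf_a (Suc 0) t = b + 1 + k" by (auto dest: less_imp_Suc_add)
    then have "t \<in> ?F k" using tail_set_step[OF t] subsetD[OF tail_set_subset_irr01 t] by auto
    then show "t \<in> (\<Union>k. ?F k)" by blast
  qed
  then have "cov_content s (tail_set \<sigma> N m b) \<le> cov_content s (\<Union>k. ?F k)"
    by (rule cov_content_mono)
  also have "\<dots> \<le> (\<Sum>k. cov_content s (?F k))" by (rule cov_content_UN)
  also have "\<dots> \<le> (\<Sum>k. ennreal (real (b + 1 + k) powr (- 2 * s)) * cov_content s (tail_set \<sigma> N (Suc m) (b + 1 + k)))"
    using s by (intro suminf_le cov_content_branch) auto
  finally show ?thesis .
qed

text \<open>As \<open>m\<close> counts the digits already removed, \<open>\<sigma> n = Suc m\<close>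
  means that the progression starts with the very next digit. It is determined by its first term
  \<open>b + 1 + k\<close> and its difference \<open>Suc d\<close>, positive because digits
  increase. Afterwards only the weak lower bound \<open>b\<close> is kept.\<close>

lemma cov_content_tail_set_AP:
  assumes s: "s > 0" and n: "N \<le> n" "\<sigma> n = Suc m"
  shows "cov_content s (tail_set \<sigma> N m b) \<le>
    (\<Sum>k. \<Sum>d. ennreal (\<Prod>i<n. real (b + 1 + k + i * Suc d) powr (- 2 * s)) * cov_content s (tail_set \<sigma> N (m + n) b))"
proof -
  let ?F = "\<lambda>k d. {x \<in> irr01. (\<forall>i<n. cf_a (Suc i) x = b + 1 + k + i * Suc d) \<and>
    (gauss_map ^^ n) x \<in> tail_set \<sigma> N (m + n) b}"
  have "tail_set \<sigma> N m b \<subseteq> (\<Union>k. \<Union>d. ?F k d)"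
  proof
    fix t assume t: "t \<in> tail_set \<sigma> N m b"
    then have "b < cf_a (Suc 0) t" and J: "t \<in> J_set" by (auto simp: tail_set_def)
    then obtain k where k: "cf_a (Suc 0) t = b + 1 + k" by (auto dest: less_imp_Suc_add)
    have "cf_a (Suc 0) t < cf_a (Suc (Suc 0)) t" using J by (auto simp: J_set_alt)
    then obtain d where d: "cf_a (Suc (Suc 0)) t = cf_a (Suc 0) t + Suc d"
      by (auto dest: less_imp_Suc_add)
    have "cf_block_AP t 1 n" using t n by (auto simp: tail_set_def)
    then have AP: "int (cf_a (Suc (Suc i)) t) - int (cf_a (Suc i) t) = int (Suc d)" if "Suc i < n" for i
      using that d by (simp add: cf_block_AP_def)
    have "cf_a (Suc i) t = b + 1 + k + i * Suc d" if "i < n" for i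
      using that
    proof (induction i)
      case (Suc i)
      then have "int (cf_a (Suc (Suc i)) t) = int (b + 1 + k + i * Suc d) + int (Suc d)"
        using AP[of i] by simp
      also have "\<dots> = int (b + 1 + k + Suc i * Suc d)" by simp
      finally show ?case by (simp only: of_nat_eq_iff)
    qed (use k in simp)
    then have "t \<in> ?F k d" using tail_set_funpow[OF t] subsetD[OF tail_set_subset_irr01 t] by auto
    then show "t \<in> (\<Union>k. \<Union>d. ?F k d)" by blast
  qed
  then have "cov_content s (tail_set \<sigma> N m b) \<le> cov_content s (\<Union>k. \<Union>d. ?F k d)"
    by (rule cov_content_mono)
  also have "\<dots> \<le> (\<Sum>k. cov_content s (\<Union>d. ?F k d))" by (rule cov_content_UN)
  also have "\<dots> \<le> (\<Sum>k. \<Sum>d. cov_content s (?F k d))" by (intro suminf_le cov_content_UN) auto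
  also have "\<dots> \<le> (\<Sum>k. \<Sum>d. ennreal (\<Prod>i<n. real (b + 1 + k + i * Suc d) powr (- 2 * s)) * cov_content s (tail_set \<sigma> N (m + n) b))"
    using s by (intro suminf_le cov_content_prefix) auto
  finally show ?thesis .
qed

text \<open>\<open>r\<close> of the factors pay for summability over the two parameters of a progression; the
  remaining ones are bounded by powers of the first term.\<close>
lemma AP_weight_le:
  fixes a d :: real
  assumes s: "s > 0" and a: "a \<ge> 1" and d: "d \<ge> 1" and q: "q \<ge> 1" and r: "s * real r \<ge> 2"
  shows "(\<Prod>i<q + r. (a + real i * d) powr (- 2 * s)) \<le> a powr (- 2 * s * real q) * (a powr - 2 * d powr - 2)"
proof -
  have "(\<Prod>i<q + j. (a + real i * d) powr (- 2 * s)) \<le> (a powr (- 2 * s)) ^ q * ((a * d) powr (- s)) ^ j" for j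
  proof (induction j)
    case 0
    have "(\<Prod>i<q. (a + real i * d) powr (- 2 * s)) \<le> (\<Prod>i<q. a powr (- 2 * s))"
      using s a d by (intro prod_mono conjI powr_mono2') auto
    then show ?case by simp
  next
    \<comment> \<open>As \<open>q + j \<ge> 1\<close>, the next term \<open>y\<close> dominates both
      \<open>a\<close> and \<open>d\<close>, so \<open>y * y \<ge> a * d\<close>: each of the last
      factors decays in both parameters.\<close>
    case (Suc j)
    define y where "y = a + real (q + j) * d"
    have "1 * d \<le> real (q + j) * d" using d q by (intro mult_right_mono) auto
    then have y: "a \<le> y" "d \<le> y" unfolding y_def using a d by linarith+
    have "y powr (- 2 * s) = (y * y) powr (- s)"
      using y a by (simp add: powr_mult flip: powr_add)
    also have "\<dots> \<le> (a * d) powr (- s)"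
      using y s a d by (intro powr_mono2' mult_mono) auto
    finally have "(\<Prod>i<q + j. (a + real i * d) powr (- 2 * s)) * y powr (- 2 * s)
        \<le> (a powr (- 2 * s)) ^ q * ((a * d) powr (- s)) ^ j * (a * d) powr (- s)"
      by (intro mult_mono Suc.IH) (auto intro!: mult_nonneg_nonneg)
    then show ?case by (simp add: y_def mult_ac)
  qed
  then have "(\<Prod>i<q + r. (a + real i * d) powr (- 2 * s)) \<le> (a powr (- 2 * s)) ^ q * ((a * d) powr (- s)) ^ r" .
  also have "(a powr (- 2 * s)) ^ q = a powr (- 2 * s * real q)"
    using a by (simp add: powr_powr flip: powr_realpow)
  also have "((a * d) powr (- s)) ^ r = (a * d) powr (- (s * real r))"
    using a d by (simp add: powr_powr flip: powr_realpow)
  also have "(a * d) powr (- (s * real r)) \<le> (a * d) powr - 2"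
    using r a d mult_mono[of 1 a 1 d] by (intro powr_mono) auto
  also have "(a * d) powr - 2 = a powr - 2 * d powr - 2" using a d by (simp add: powr_mult)
  finally show ?thesis by (simp add: mult_left_mono)
qed

section \<open>Summation over free digits and over progressions\<close>

definition zeta_tail :: "real \<Rightarrow> nat \<Rightarrow> ennreal" where
  "zeta_tail \<tau> P = (\<Sum>k. ennreal (real (P + 1 + k) powr - \<tau>))"

lemma zeta_tail_antimono:
  assumes "\<tau> > 0" "P \<le> b" shows "zeta_tail \<tau> b \<le> zeta_tail \<tau> P"
  unfolding zeta_tail_def using assms
  by (intro suminf_le ennreal_leI powr_mono2') auto

lemma zeta_tail_small:
  assumes "\<tau> > 1" "e > 0" obtains P where "P \<ge> 1" "zeta_tail \<tau> P \<le> ennreal e"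
proof -
  have sm: "summable (\<lambda>k. real k powr - \<tau>)" using assms by (simp add: summable_real_powr_iff)
  obtain M where M: "\<And>n. n \<ge> M \<Longrightarrow> norm (\<Sum>i. real (i + n) powr - \<tau>) < e"
    using suminf_exist_split[OF assms(2) sm] by blast
  define P where "P = M + 1"
  have "zeta_tail \<tau> P = ennreal (\<Sum>k. real (k + (P + 1)) powr - \<tau>)"
    unfolding zeta_tail_def
    using summable_ignore_initial_segment[OF sm, of "P + 1"]
    by (subst suminf_ennreal2) (auto simp: ac_simps)
  also have "\<dots> \<le> ennreal e" using M[of "P + 1"] by (intro ennreal_leI) (simp add: P_def)
  finally show ?thesis using that[of P] by (simp add: P_def)
qed

text \<open>The weight \<open>f powr (- 2 * s)\<close> of a free digit \<open>f\<close> is split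
  into \<open>f powr - \<tau>\<close>, whose sum over \<open>f > b\<close> is at most 1, and
  \<open>f powr (\<tau> - 2 * s)\<close>, which joins the power inherited from later digits. Each
  free digit thus changes the exponent by \<open>2 * s - \<tau>\<close>; if this is negative, it
  consumes the exponent \<kappa> earned by the next progression.\<close>

lemma cov_content_free_digits:
  assumes s: "s > 0" and \<tau>: "\<tau> > 0" and P: "P \<ge> 1" "zeta_tail \<tau> P \<le> 1" and K: "K \<ge> 0"
    and \<kappa>: "\<kappa> \<ge> 0" "\<kappa> + real g * (2 * s - \<tau>) \<ge> 0"
    and bound: "\<And>b. b \<ge> P \<Longrightarrow> cov_content s (tail_set \<sigma> N (m + g) b) \<le> ennreal (K * real b powr - \<kappa>)"
  shows "b \<ge> P \<Longrightarrow> cov_content s (tail_set \<sigma> N m b) \<le> ennreal (K * real b powr - (\<kappa> + real g * (2 * s - \<tau>)))"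
  using \<kappa>(2) bound
proof (induction g arbitrary: m b)
  case 0
  then show ?case by simp
next
  case (Suc g)
  define \<mu> where "\<mu> = \<kappa> + real (Suc g) * (2 * s - \<tau>)"
  have \<mu>: "\<mu> \<ge> 0" using Suc.prems by (simp add: \<mu>_def)
  \<comment> \<open>The exponent is affine in the number of free digits and nonnegative at 0 and at
    \<open>Suc g\<close>, hence at \<open>g\<close>.\<close>
  have "\<kappa> + real g * (2 * s - \<tau>) \<ge> 0"
  proof (cases "2 * s \<ge> \<tau>")
    case True
    then show ?thesis using \<kappa>(1) by simp
  next
    case False
    then show ?thesis using \<mu> by (simp add: \<mu>_def algebra_simps)
  qed
  then have IH: "cov_content s (tail_set \<sigma> N (Suc m) c) \<le> ennreal (K * real c powr - (\<kappa> + real g * (2 * s - \<tau>)))"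
    if "c \<ge> P" for c
    using Suc.prems that by (intro Suc.IH) auto
  have summand: "ennreal (real (b + 1 + k) powr (- 2 * s)) * cov_content s (tail_set \<sigma> N (Suc m) (b + 1 + k))
      \<le> ennreal (K * real b powr - \<mu>) * ennreal (real (b + 1 + k) powr - \<tau>)" for k
  proof -
    define f where "f = real (b + 1 + k)"
    have f: "f \<ge> 1" "real b \<le> f" "real b > 0" using Suc.prems P by (auto simp: f_def)
    have "ennreal (f powr (- 2 * s)) * cov_content s (tail_set \<sigma> N (Suc m) (b + 1 + k))
      \<le> ennreal (f powr (- 2 * s)) * ennreal (K * f powr - (\<kappa> + real g * (2 * s - \<tau>)))"
      unfolding f_def using Suc.prems by (intro mult_left_mono IH) auto
    also have "\<dots> = ennreal (K * (f powr (- 2 * s) * f powr - (\<kappa> + real g * (2 * s - \<tau>))))"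
      using K by (simp flip: ennreal_mult add: mult_ac)
    also have "f powr (- 2 * s) * f powr - (\<kappa> + real g * (2 * s - \<tau>)) = f powr - \<mu> * f powr - \<tau>"
      by (simp flip: powr_add add: \<mu>_def algebra_simps)
    also have "ennreal (K * (f powr - \<mu> * f powr - \<tau>)) \<le> ennreal (K * (real b powr - \<mu> * f powr - \<tau>))"
      using K f \<mu> by (intro ennreal_leI mult_left_mono mult_right_mono powr_mono2') auto
    also have "\<dots> = ennreal (K * real b powr - \<mu>) * ennreal (f powr - \<tau>)"
      using K by (simp flip: ennreal_mult add: mult_ac)
    finally show ?thesis by (simp add: f_def)
  qed
  have "cov_content s (tail_set \<sigma> N m b) \<le>
    (\<Sum>k. ennreal (real (b + 1 + k) powr (- 2 * s)) * cov_content s (tail_set \<sigma> N (Suc m) (b + 1 + k)))"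
    by (rule cov_content_tail_set_step[OF s])
  also have "\<dots> \<le> (\<Sum>k. ennreal (K * real b powr - \<mu>) * ennreal (real (b + 1 + k) powr - \<tau>))"
    by (intro suminf_le summand) auto
  also have "\<dots> = ennreal (K * real b powr - \<mu>) * zeta_tail \<tau> b" by (simp add: zeta_tail_def)
  also have "\<dots> \<le> ennreal (K * real b powr - \<mu>) * 1"
    using zeta_tail_antimono[OF \<tau> Suc.prems(1)] P by (intro mult_left_mono) auto
  finally show ?case by (simp add: \<mu>_def)
qed

text \<open>Only \<open>n - r\<close> digits of the progression become a power of \<open>b\<close>;
  the other \<open>r\<close> make the sum over first term and difference converge. The choice of
  \<open>P\<close> brings that double sum below \<open>1 / 2\<close>, a gain collected at every
  progression.\<close>

lemma cov_content_AP_block: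
  assumes s: "s > 0" and r: "s * real r \<ge> 2" and n: "N \<le> n" "r < n" "\<sigma> n = Suc m"
    and P: "P \<ge> 1" "zeta_tail 2 P * zeta_tail 2 0 \<le> ennreal (1 / 2)" and K: "K \<ge> 0"
    and bound: "cov_content s (tail_set \<sigma> N (m + n) P) \<le> ennreal K" and b: "b \<ge> P"
  shows "cov_content s (tail_set \<sigma> N m b) \<le> ennreal (K / 2 * real b powr - (2 * s * real (n - r)))"
proof -
  define w where "w = real b powr - (2 * s * real (n - r))"
  have summand: "ennreal (\<Prod>i<n. real (b + 1 + k + i * Suc d) powr (- 2 * s)) * cov_content s (tail_set \<sigma> N (m + n) b)
      \<le> ennreal (K * w) * ennreal (real (b + 1 + k) powr - 2) * ennreal (real (0 + 1 + d) powr - 2)" for k d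
  proof -
    have "(\<Prod>i<n. real (b + 1 + k + i * Suc d) powr (- 2 * s))
        = (\<Prod>i<(n - r) + r. (real (b + 1 + k) + real i * real (Suc d)) powr (- 2 * s))"
      using n by (intro prod.cong) (auto simp: algebra_simps)
    also have "\<dots> \<le> real (b + 1 + k) powr (- 2 * s * real (n - r)) *
        (real (b + 1 + k) powr - 2 * real (Suc d) powr - 2)"
      using s r n by (intro AP_weight_le) auto
    also have "\<dots> \<le> w * (real (b + 1 + k) powr - 2 * real (Suc d) powr - 2)"
      unfolding w_def using s b P by (auto intro!: mult_right_mono powr_mono2')
    finally have le: "(\<Prod>i<n. real (b + 1 + k + i * Suc d) powr (- 2 * s))
        \<le> w * (real (b + 1 + k) powr - 2 * real (Suc d) powr - 2)" .
    have "cov_content s (tail_set \<sigma> N (m + n) b) \<le> ennreal K"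
      using cov_content_mono[OF tail_set_antimono[OF b]] bound order_trans by blast
    then have "ennreal (\<Prod>i<n. real (b + 1 + k + i * Suc d) powr (- 2 * s)) * cov_content s (tail_set \<sigma> N (m + n) b)
      \<le> ennreal (w * (real (b + 1 + k) powr - 2 * real (Suc d) powr - 2)) * ennreal K"
      using le by (intro mult_mono ennreal_leI) auto
    also have "\<dots> = ennreal (K * w) * ennreal (real (b + 1 + k) powr - 2) * ennreal (real (0 + 1 + d) powr - 2)"
      using K by (simp flip: ennreal_mult add: w_def mult_ac)
    finally show ?thesis .
  qed
  have "cov_content s (tail_set \<sigma> N m b) \<le>
    (\<Sum>k. \<Sum>d. ennreal (\<Prod>i<n. real (b + 1 + k + i * Suc d) powr (- 2 * s)) * cov_content s (tail_set \<sigma> N (m + n) b))"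
    using s n by (intro cov_content_tail_set_AP) auto
  also have "\<dots> \<le> (\<Sum>k. \<Sum>d. ennreal (K * w) * ennreal (real (b + 1 + k) powr - 2) * ennreal (real (0 + 1 + d) powr - 2))"
    by (intro suminf_le summand) auto
  also have "\<dots> = ennreal (K * w) * (zeta_tail 2 b * zeta_tail 2 0)"
    unfolding zeta_tail_def by (simp add: mult.assoc)
  also have "\<dots> \<le> ennreal (K * w) * ennreal (1 / 2)"
  proof (rule mult_left_mono)
    have "zeta_tail 2 b * zeta_tail 2 0 \<le> zeta_tail 2 P * zeta_tail 2 0"
      using b by (intro mult_right_mono zeta_tail_antimono) auto
    then show "zeta_tail 2 b * zeta_tail 2 0 \<le> ennreal (1 / 2)" using P(2) by (rule order_trans)
  qed simp
  also have "\<dots> = ennreal (K / 2 * w)" using K by (subst ennreal_mult[symmetric]) (auto simp: w_def)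
  finally show ?thesis by (simp add: w_def)
qed


text \<open>One stage consists of the free digits after progression \<open>n\<close> followed by
  progression \<open>Suc n\<close>. By \<open>ev\<close> the exponent lost to the free digits is
  covered by what the progression earns without \<open>r\<close> of its digits, so each stage gains
  a factor \<open>1 / 2\<close>. Infinitely many stages give content zero.\<close>

lemma hausdorff_measure_G_set_null:
  assumes gap: "\<forall>n\<ge>1. \<sigma> (Suc n) \<ge> \<sigma> n + n" and pos: "\<forall>n\<ge>1. 0 < \<sigma> n"
    and s: "s > 0" and \<tau>: "\<tau> > 1"
    and ev: "\<And>r. eventually (\<lambda>n. \<tau> * (real (\<sigma> (Suc n)) - real (\<sigma> n) - real n)
          \<le> 2 * s * (real (\<sigma> (Suc n)) - real (\<sigma> n) - real r)) sequentially"
  shows "hausdorff_measure s (G_set \<sigma>) = 0"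
proof -
  \<comment> \<open>This many digits of a progression supply the exponent 2 for each of its two
    parameters.\<close>
  obtain r where r: "s * real r \<ge> 2"
    using reals_Archimedean3[OF s] by (metis less_imp_le mult.commute)
  obtain P1 where P1: "P1 \<ge> 1" "zeta_tail \<tau> P1 \<le> ennreal 1" using zeta_tail_small[OF \<tau>, of 1] by auto
  have "zeta_tail 2 0 < top"
  proof -
    have "zeta_tail 2 0 = ennreal (\<Sum>k. real (k + 1) powr - 2)"
      unfolding zeta_tail_def
      using summable_ignore_initial_segment[of "\<lambda>k. real k powr - 2" 1]
      by (subst suminf_ennreal2) (auto simp: ac_simps summable_real_powr_iff)
    then show ?thesis by simp
  qed
  then obtain Z where Z: "zeta_tail 2 0 = ennreal Z" "Z \<ge> 0" by (cases "zeta_tail 2 0") auto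
  \<comment> \<open>Then \<open>zeta_tail 2 P2 * Z\<close> is at most
    \<open>Z / (2 * (Z + 1)) \<le> 1 / 2\<close>.\<close>
  obtain P2 where P2: "zeta_tail 2 P2 \<le> ennreal (1 / (2 * (Z + 1)))"
    using zeta_tail_small[of 2 "1 / (2 * (Z + 1))"] Z by auto
  define P where "P = max P1 P2"
  have P: "P \<ge> 1" "zeta_tail \<tau> P \<le> 1" "zeta_tail 2 P * zeta_tail 2 0 \<le> ennreal (1 / 2)"
  proof -
    show "P \<ge> 1" using P1 by (simp add: P_def)
    show "zeta_tail \<tau> P \<le> 1"
      using zeta_tail_antimono[of \<tau> P1 P] P1 \<tau> by (simp add: P_def)
    have "zeta_tail 2 P * zeta_tail 2 0 \<le> ennreal (1 / (2 * (Z + 1))) * ennreal Z"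
      using zeta_tail_antimono[of 2 P2 P] P2 Z by (intro mult_mono) (auto simp: P_def)
    also have "\<dots> = ennreal (1 / (2 * (Z + 1)) * Z)" using Z by (intro ennreal_mult[symmetric]) auto
    also have "\<dots> \<le> ennreal (1 / 2)" using Z by (intro ennreal_leI) (simp add: field_simps)
    finally show "zeta_tail 2 P * zeta_tail 2 0 \<le> ennreal (1 / 2)" .
  qed
  obtain N0 where N0: "\<And>n. n \<ge> N0 \<Longrightarrow> \<tau> * (real (\<sigma> (Suc n)) - real (\<sigma> n) - real n)
          \<le> 2 * s * (real (\<sigma> (Suc n)) - real (\<sigma> n) - real r)"
    using ev[of r] unfolding eventually_sequentially by blast
  \<comment> \<open>Progression \<open>n\<close> occupies the positions \<open>\<sigma> n\<close> to
    \<open>\<sigma> n + n - 1\<close>, so it is complete once \<open>p n\<close> digits are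
    removed.\<close>
  define p where "p n = \<sigma> n - 1 + n" for n
  \<comment> \<open>Here \<open>k\<close> counts the stages unfolded, beginning with the trivial
    bound 1; \<open>n\<close> varies in the induction since each stage moves on to
    \<open>Suc n\<close>.\<close>
  have stage: "cov_content s (tail_set \<sigma> N (p n) P) \<le> ennreal ((1 / 2) ^ k)"
    if "N \<le> n" "N0 + r + 1 \<le> n" for N n k
    using that
  proof (induction k arbitrary: n)
    case 0
    then show ?case using cov_content_tail_set_le_1[OF s] by simp
  next
    case (Suc k)
    define m where "m = \<sigma> (Suc n) - 1"
    define g where "g = \<sigma> (Suc n) - \<sigma> n - n"
    have gp: "\<sigma> (Suc n) \<ge> \<sigma> n + n" "\<sigma> n > 0" "\<sigma> (Suc n) > 0"
      using gap pos Suc.prems by auto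
    have m: "\<sigma> (Suc n) = Suc m" "p n + g = m" "p (Suc n) = m + Suc n"
      using gp by (auto simp: m_def p_def g_def)
    define \<kappa> where "\<kappa> = 2 * s * real (Suc n - r)"
    have g: "real g = real (\<sigma> (Suc n)) - real (\<sigma> n) - real n" using gp by (simp add: g_def of_nat_diff)
    have "\<tau> * real g \<le> 2 * s * (real g + real n - real r)"
      using N0[of n] Suc.prems unfolding g by simp
    \<comment> \<open>\<open>N0\<close> accounts for \<open>n - r\<close> paying digits, while the
      next progression has \<open>Suc n - r\<close> of them, so one is to spare.\<close>
    then have \<kappa>2: "\<kappa> + real g * (2 * s - \<tau>) \<ge> 0"
      using Suc.prems s by (simp add: \<kappa>_def of_nat_diff algebra_simps)
    have "cov_content s (tail_set \<sigma> N m b) \<le> ennreal ((1 / 2) ^ k / 2 * real b powr - \<kappa>)" if "b \<ge> P" for b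
      unfolding \<kappa>_def using Suc.prems Suc.IH[of "Suc n"] m that s r P
      by (intro cov_content_AP_block) auto
    then have "cov_content s (tail_set \<sigma> N (p n) P) \<le>
        ennreal ((1 / 2) ^ k / 2 * real P powr - (\<kappa> + real g * (2 * s - \<tau>)))"
      using s \<tau> P \<kappa>2 m by (intro cov_content_free_digits[where P = P]) (auto simp: \<kappa>_def)
    also have "\<dots> \<le> ennreal ((1 / 2) ^ k / 2 * 1)"
      using P \<kappa>2 powr_mono[of "- (\<kappa> + real g * (2 * s - \<tau>))" 0 "real P"]
      by (intro ennreal_leI mult_left_mono) auto
    finally show ?case by simp
  qed
  have null: "cov_content s (tail_set \<sigma> N (p N) P) = 0" if "N0 + r + 1 \<le> N" for N
  proof -
    have "(\<lambda>k. ennreal ((1 / 2) ^ k)) \<longlonglongrightarrow> ennreal 0"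
      by (intro tendsto_ennrealI LIMSEQ_power_zero) simp
    then have "cov_content s (tail_set \<sigma> N (p N) P) \<le> ennreal 0"
      by (rule LIMSEQ_le_const) (use stage[OF order_refl that] in auto)
    then show ?thesis by simp
  qed
  \<comment> \<open>The start index exceeds \<open>N0 + r\<close> as \<open>null\<close> demands, is
    at least \<open>P\<close> so that the digits after position \<open>p (W k)\<close> exceed
    \<open>P\<close>, and is at least \<open>k\<close> so that all later blocks are
    progressions.\<close>
  define W where "W k = N0 + r + 1 + P + k" for k
  have "G_set \<sigma> \<subseteq> (\<Union>k. {x \<in> irr01. (gauss_map ^^ p (W k)) x \<in> tail_set \<sigma> (W k) (p (W k)) P})"
  proof
    fix x assume x: "x \<in> G_set \<sigma>"
    then obtain k where k: "\<And>n. n \<ge> k \<Longrightarrow> cf_block_AP x (\<sigma> n) n" and J: "x \<in> J_set"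
      by (auto simp: G_set_def)
    define m where "m = p (W k)"
    have m: "m \<ge> P" by (simp add: m_def p_def W_def)
    have "P < cf_a (Suc 0) ((gauss_map ^^ m) x)"
      using J_set_digit_ge[OF J, of "Suc m"] m cf_a_shift[of "Suc 0" m x] by simp
    moreover have "cf_block_AP ((gauss_map ^^ m) x) (\<sigma> n - m) n" if "n \<ge> W k" "m < \<sigma> n" for n
      using that k[of n] by (subst cf_block_AP_shift) (auto simp: W_def)
    ultimately have "(gauss_map ^^ m) x \<in> tail_set \<sigma> (W k) m P"
      by (simp add: tail_set_def J_set_funpow J)
    moreover have "x \<in> irr01" using J by (simp add: J_set_alt)
    ultimately show "x \<in> (\<Union>k. {x \<in> irr01. (gauss_map ^^ p (W k)) x \<in> tail_set \<sigma> (W k) (p (W k)) P})"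
      unfolding m_def by blast
  qed
  then have "cov_content s (G_set \<sigma>) = 0"
    by (rule cov_content_null_subset[rotated])
       (intro cov_content_UN_null cov_content_gauss_preimage_null s null, simp add: W_def)
  then show ?thesis by (rule hausdorff_measure_null[OF s])
qed

section \<open>Cantor sets of continued fractions\<close>

text \<open>Lebesgue measure serves as mass distribution: the preimage under \<open>g\<close> of a
  covering set lies in an interval of length \<open>2 * C * diameter powr s\<close>, and these
  intervals cover \<open>[0, 1)\<close>. So no cover has weight below
  \<open>1 / (2 * C)\<close>.\<close>

lemma hausdorff_measure_ne_0:
  fixes g :: "real \<Rightarrow> real"
  assumes s: "s > 0" and C: "C > 0"
    and gE: "\<And>z. z \<in> {0..<1} \<Longrightarrow> g z \<in> E"
    and holder: "\<And>z w. z \<in> {0..<1} \<Longrightarrow> w \<in> {0..<1} \<Longrightarrow> \<bar>z - w\<bar> \<le> C * \<bar>g z - g w\<bar> powr s"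
  shows "hausdorff_measure s E \<noteq> 0"
proof -
  have "ennreal (1 / (2 * C)) \<le> hausdorff_content 1 s E"
    unfolding hausdorff_content_def
  proof (rule INF_greatest)
    fix U :: "nat \<Rightarrow> real set"
    assume "U \<in> {U. E \<subseteq> (\<Union>i. U i) \<and> (\<forall>i. bounded (U i) \<and> diameter (U i) \<le> 1)}"
    then have U: "E \<subseteq> (\<Union>i. U i)" "\<And>i. bounded (U i)" by auto
    define S where "S i = {z \<in> {0..<1}. g z \<in> U i}" for i
    define d where "d i = C * diameter (U i) powr s" for i
    \<comment> \<open>If \<open>S i\<close> is empty the centre is arbitrary, and the extra interval
      does no harm.\<close>
    define c where "c i = (SOME z. z \<in> S i)" for i
    have sub: "S i \<subseteq> {c i - d i..c i + d i}" for i
    proof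
      fix z assume z: "z \<in> S i"
      then have c: "c i \<in> S i" unfolding c_def by (rule someI)
      have "\<bar>g z - g (c i)\<bar> \<le> diameter (U i)"
        using diameter_bounded_bound[OF U(2), of "g z" i "g (c i)"] z c
        by (simp add: S_def dist_real_def)
      then have "\<bar>g z - g (c i)\<bar> powr s \<le> diameter (U i) powr s" using s by (intro powr_mono2) auto
      then have "C * \<bar>g z - g (c i)\<bar> powr s \<le> d i" unfolding d_def using C by simp
      moreover have "\<bar>z - c i\<bar> \<le> C * \<bar>g z - g (c i)\<bar> powr s"
        using z c by (intro holder) (auto simp: S_def)
      ultimately show "z \<in> {c i - d i..c i + d i}" by auto
    qed
    have "{0..<1} \<subseteq> (\<Union>i. {c i - d i..c i + d i})"
    proof
      fix z :: real assume z: "z \<in> {0..<1}"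
      then obtain i where "g z \<in> U i" using gE[of z] U(1) by auto
      then have "z \<in> S i" using z by (simp add: S_def)
      then show "z \<in> (\<Union>i. {c i - d i..c i + d i})" using sub[of i] by blast
    qed
    then have "emeasure lborel {0..<1::real} \<le> emeasure lborel (\<Union>i. {c i - d i..c i + d i})"
      by (intro emeasure_mono) auto
    also have "\<dots> \<le> (\<Sum>i. emeasure lborel {c i - d i..c i + d i})"
      by (intro emeasure_subadditive_countably) auto
    also have "\<dots> = (\<Sum>i. ennreal (2 * C) * ennreal (diam_pow s (U i)))"
    proof (rule suminf_cong)
      fix i
      have "d i \<ge> 0" using C by (simp add: d_def)
      then show "emeasure lborel {c i - d i..c i + d i} = ennreal (2 * C) * ennreal (diam_pow s (U i))"
        using C s by (simp add: diam_pow_eq d_def flip: ennreal_mult)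
    qed
    also have "\<dots> = ennreal (2 * C) * (\<Sum>i. ennreal (diam_pow s (U i)))" by simp
    finally have "ennreal 1 \<le> ennreal (2 * C) * (\<Sum>i. ennreal (diam_pow s (U i)))" by simp
    then have "ennreal (1 / (2 * C)) * ennreal 1
        \<le> ennreal (1 / (2 * C)) * (ennreal (2 * C) * (\<Sum>i. ennreal (diam_pow s (U i))))"
      by (rule mult_left_mono) simp
    then show "ennreal (1 / (2 * C)) \<le> (\<Sum>i. ennreal (diam_pow s (U i)))"
      using C by (simp flip: ennreal_mult mult.assoc)
  qed
  also have "\<dots> \<le> hausdorff_measure s E" unfolding hausdorff_measure_def by (intro SUP_upper) simp
  finally show ?thesis using C by (auto simp: ennreal_eq_0_iff)
qed

section \<open>Mixed radix expansions\<close>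

fun mr_rem :: "(nat \<Rightarrow> nat) \<Rightarrow> real \<Rightarrow> nat \<Rightarrow> real" where
  "mr_rem m z 0 = z"
| "mr_rem m z (Suc n) = frac (real (m n) * mr_rem m z n)"

text \<open>The digits \<open>d n\<close> in the expansion of \<open>z\<close> as the sum of
  \<open>d n / (m 0 * ... * m n)\<close>; \<open>mr_rem\<close> is the rescaled remainder after
  \<open>n\<close> digits.\<close>

definition mr_digit :: "(nat \<Rightarrow> nat) \<Rightarrow> real \<Rightarrow> nat \<Rightarrow> nat" where
  "mr_digit m z n = nat \<lfloor>real (m n) * mr_rem m z n\<rfloor>"

lemma mr_rem_range: "z \<in> {0..<1} \<Longrightarrow> mr_rem m z n \<in> {0..<1}"
  by (cases n) (auto simp: frac_lt_1)

lemma mr_digit_less: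
  assumes "z \<in> {0..<1}" "m n \<ge> 1" shows "mr_digit m z n < m n"
proof -
  have "real (m n) * mr_rem m z n < real (m n)"
    using assms mr_rem_range[OF assms(1), of m n]
      mult_strict_left_mono[of "mr_rem m z n" 1 "real (m n)"] by simp
  then have "\<lfloor>real (m n) * mr_rem m z n\<rfloor> < int (m n)" by linarith
  then show ?thesis unfolding mr_digit_def using assms by linarith
qed

text \<open>A step with equal digits multiplies the difference of the remainders by exactly
  \<open>m n\<close>, and remainders never leave \<open>[0, 1)\<close>.\<close>

lemma mr_digit_eq_dist:
  assumes "z \<in> {0..<1}" "w \<in> {0..<1}" "\<And>i. i < n \<Longrightarrow> mr_digit m z i = mr_digit m w i"
  shows "\<bar>z - w\<bar> * real (\<Prod>i<n. m i) \<le> 1"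
proof -
  have "\<bar>z - w\<bar> * real (\<Prod>i<n. m i) = \<bar>mr_rem m z n - mr_rem m w n\<bar>"
    using assms(3)
  proof (induction n)
    case (Suc n)
    have nonneg: "real (m n) * mr_rem m y n \<ge> 0" if "y \<in> {0..<1}" for y
      using mr_rem_range[OF that, of m n] by auto
    have "\<lfloor>real (m n) * mr_rem m z n\<rfloor> = \<lfloor>real (m n) * mr_rem m w n\<rfloor>"
      using Suc.prems[of n] nonneg[OF assms(1)] nonneg[OF assms(2)]
      by (simp add: mr_digit_def eq_nat_nat_iff)
    then have "mr_rem m z (Suc n) - mr_rem m w (Suc n) = (mr_rem m z n - mr_rem m w n) * real (m n)"
      by (simp add: frac_def algebra_simps)
    then have "\<bar>mr_rem m z (Suc n) - mr_rem m w (Suc n)\<bar> = \<bar>mr_rem m z n - mr_rem m w n\<bar> * real (m n)"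
      by (simp add: abs_mult)
    then show ?case using Suc.IH Suc.prems by (simp add: mult_ac)
  qed simp
  also have "\<dots> \<le> 1" using mr_rem_range[OF assms(1), of m n] mr_rem_range[OF assms(2), of m n] by auto
  finally show ?thesis .
qed

section \<open>Points with prescribed partial quotients\<close>

lemma gauss_map_rational_terminates: "p > 0 \<Longrightarrow> \<exists>n. (gauss_map ^^ n) (real p / real q) = 0"
proof (induction p arbitrary: q rule: less_induct)
  case (less p)
  \<comment> \<open>This is the Euclidean algorithm: the new numerator \<open>q mod p\<close> is
    smaller than \<open>p\<close>.\<close>
  have "gauss_map (real p / real q) = real q / real p - real (q div p)"
    by (simp add: gauss_map_def frac_def floor_divide_of_nat_eq)
  also have "\<dots> = real (q mod p) / real p"
  proof -
    have "real q = real (q div p) * real p + real (q mod p)" by (simp flip: of_nat_mult of_nat_add)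
    then show ?thesis using less.prems by (simp add: field_simps)
  qed
  finally have eq: "gauss_map (real p / real q) = real (q mod p) / real p" .
  show ?case
  proof (cases "q mod p = 0")
    case True
    then have "(gauss_map ^^ 1) (real p / real q) = 0" using eq by simp
    then show ?thesis by blast
  next
    case False
    then obtain n where "(gauss_map ^^ n) (real (q mod p) / real p) = 0"
      using less.IH[of "q mod p" p] less.prems by auto
    then have "(gauss_map ^^ Suc n) (real p / real q) = 0"
      by (simp del: funpow.simps add: funpow_Suc_right eq)
    then show ?thesis by blast
  qed
qed

text \<open>The finite continued fraction with digits \<open>a 0, ..., a (n - 1)\<close> and tail
  \<open>t\<close>. A new digit enters innermost, which makes the images of \<open>[0, 1]\<close>
  nested.\<close>

fun cf_branch :: "(nat \<Rightarrow> nat) \<Rightarrow> nat \<Rightarrow> real \<Rightarrow> real" where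
  "cf_branch a 0 t = t"
| "cf_branch a (Suc n) t = cf_branch a n (1 / (real (a n) + t))"

text \<open>By compactness the nested images of \<open>[0, 1]\<close> have a common point
  \<open>x\<close>. Injectivity of the branches links its preimages by
  \<open>t n = 1 / (a n + t (Suc n))\<close>, so the \<open>t n\<close> are its Gauss
  iterates.\<close>

lemma cf_exists:
  assumes a: "\<And>i. a i \<ge> 1"
  shows "\<exists>x\<in>irr01. \<forall>i. cf_a (Suc i) x = a i"
proof -
  have range1: "1 / (real (a n) + t) \<in> {0..1}" if "t \<in> {0..1}" for t n
    using that a[of n] by (auto simp: divide_simps)
  have cont: "continuous_on {0..1} (cf_branch a n)" for n
  proof (induction n)
    case 0
    show ?case by (simp add: cf_branch.simps(1)[abs_def])
  next
    case (Suc n)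
    have "continuous_on {0..1} (\<lambda>t. cf_branch a n (1 / (real (a n) + t)))"
      using range1 a[of n]
      by (intro continuous_on_compose2[OF Suc] continuous_intros) auto
    then show ?case by (simp add: cf_branch.simps(2)[abs_def])
  qed
  have inj: "t = u" if "t \<in> {0..1}" "u \<in> {0..1}" "cf_branch a n t = cf_branch a n u" for t u n
    using that
  proof (induction n arbitrary: t u)
    case (Suc n)
    have "1 / (real (a n) + t) = 1 / (real (a n) + u)"
      by (rule Suc.IH[OF range1 range1]) (use Suc.prems in auto)
    then show ?case using Suc.prems a[of n] by (simp add: field_simps)
  qed simp
  have "(\<Inter>n. cf_branch a n ` {0..1}) \<noteq> {}"
  proof (rule compact_nest)
    show "compact (cf_branch a n ` {0..1})" for n by (intro compact_continuous_image cont) simp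
    have "cf_branch a (Suc n) ` {0..1} \<subseteq> cf_branch a n ` {0..1}" for n
      using range1[of _ n] by auto
    then show "m \<le> n \<Longrightarrow> cf_branch a n ` {0..1} \<subseteq> cf_branch a m ` {0..1}" for m n
      by (rule lift_Suc_antimono_le)
  qed simp
  then obtain x where "\<And>n. x \<in> cf_branch a n ` {0..1}" by auto
  then have "\<forall>n. \<exists>t. t \<in> {0..1} \<and> x = cf_branch a n t" by blast
  then obtain t where t: "\<And>n. t n \<in> {0..1}" "\<And>n. x = cf_branch a n (t n)" by metis
  have rec: "t n = 1 / (real (a n) + t (Suc n))" for n
    using t(2)[of n] t(2)[of "Suc n"] inj[OF t(1) range1[OF t(1)], of n n n "Suc n"] by simp
  have pos: "t n > 0" for n
    using rec[of n] a[of n] t(1)[of "Suc n"] by (auto simp: add_nonneg_pos add_pos_nonneg)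
  \<comment> \<open>Strictness comes from \<open>t (Suc n) > 0\<close>, which matters when
    \<open>a n = 1\<close>.\<close>
  have lt1: "t n < 1" for n
    unfolding rec[of n] using a[of n] pos[of "Suc n"] by simp
  have inv: "1 / t n = real (a n) + t (Suc n)" for n by (subst rec) simp
  have fl: "\<lfloor>1 / t n\<rfloor> = int (a n)" for n
    unfolding inv using pos[of "Suc n"] lt1[of "Suc n"] by (simp add: floor_eq_iff)
  have gm: "gauss_map (t n) = t (Suc n)" for n
    unfolding gauss_map_def frac_def fl by (simp add: inv)
  have iter: "(gauss_map ^^ n) x = t n" for n
    by (induction n) (use t(2)[of 0] in \<open>auto simp: gm\<close>)
  \<comment> \<open>The Gauss orbit of a positive rational reaches 0, while every iterate
    \<open>t n\<close> of \<open>x\<close> is positive.\<close>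
  have "x \<notin> \<rat>"
  proof
    assume "x \<in> \<rat>"
    then obtain p q where pq: "q \<noteq> 0" "\<bar>x\<bar> = real p / real q" by (rule Rats_abs_nat_div_natE)
    moreover have "x > 0" using pos[of 0] iter[of 0] by simp
    ultimately have "x = real p / real q" "p > 0" by (auto intro: Nat.gr0I)
    then obtain n where "(gauss_map ^^ n) x = 0" using gauss_map_rational_terminates by blast
    then show False using pos[of n] iter by simp
  qed
  then have "x \<in> irr01" using pos[of 0] lt1[of 0] iter[of 0] by (simp add: irr01_def)
  moreover have "cf_a (Suc i) x = a i" for i by (simp add: cf_a_def iter fl)
  ultimately show ?thesis by blast
qed

section \<open>Distances between points with known partial quotients\<close>

lemma gauss_map_dist:
  assumes x: "x \<in> irr01" "y \<in> irr01"
  shows "\<bar>x - y\<bar> * ((real (cf_a (Suc 0) x) + gauss_map x) * (real (cf_a (Suc 0) y) + gauss_map y)) =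
    \<bar>real (cf_a (Suc 0) x) + gauss_map x - (real (cf_a (Suc 0) y) + gauss_map y)\<bar>"
proof -
  define u where "u = real (cf_a (Suc 0) x) + gauss_map x"
  define v where "v = real (cf_a (Suc 0) y) + gauss_map y"
  have pos: "u > 0" "v > 0"
    using gauss_map_irr01[OF x(1)] gauss_map_irr01[OF x(2)]
    by (auto simp: u_def v_def irr01_def add_nonneg_pos)
  have "x = 1 / u" "y = 1 / v" using cf_expand x by (auto simp: u_def v_def)
  then have "(x - y) * (u * v) = v - u" using pos by (simp add: field_simps)
  then have "\<bar>x - y\<bar> * (u * v) = \<bar>v - u\<bar>" using pos by (metis abs_mult abs_of_pos mult_pos_pos)
  then show ?thesis by (simp add: u_def v_def abs_minus_commute)
qed

text \<open>On a common digit \<open>a\<close> with tails \<open>t\<close> and \<open>u\<close> the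
  Gauss map expands the distance by \<open>(a + t) * (a + u)\<close>, and \<open>a < B\<close> for
  integers gives \<open>a + t \<le> B\<close>.\<close>

lemma cf_prefix_dist:
  assumes xy: "x \<in> irr01" "y \<in> irr01"
    and eq: "\<And>i. i < n \<Longrightarrow> cf_a (Suc i) x = cf_a (Suc i) y"
    and B: "\<And>i. i < n \<Longrightarrow> cf_a (Suc i) x < B i"
  shows "\<bar>(gauss_map ^^ n) x - (gauss_map ^^ n) y\<bar> \<le> \<bar>x - y\<bar> * (real (\<Prod>i<n. B i))\<^sup>2"
  using eq B
proof (induction n)
  case (Suc n)
  let ?x = "(gauss_map ^^ n) x" and ?y = "(gauss_map ^^ n) y"
  have irr: "?x \<in> irr01" "?y \<in> irr01" using xy by (auto intro: gauss_map_funpow_irr01)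
  have dig: "cf_a (Suc 0) ?x = cf_a (Suc n) x" "cf_a (Suc 0) ?y = cf_a (Suc n) x"
    using cf_a_shift[of "Suc 0" n] Suc.prems(1)[of n] by auto
  have le: "real (cf_a (Suc n) x) + gauss_map ?x \<le> real (B n)" "real (cf_a (Suc n) x) + gauss_map ?y \<le> real (B n)"
    using Suc.prems(2)[of n] gauss_map_irr01[OF irr(1)] gauss_map_irr01[OF irr(2)] by (auto simp: irr01_def)
  have "\<bar>gauss_map ?x - gauss_map ?y\<bar> = \<bar>?x - ?y\<bar> *
      ((real (cf_a (Suc n) x) + gauss_map ?x) * (real (cf_a (Suc n) x) + gauss_map ?y))"
    using gauss_map_dist[OF irr] dig by simp
  also have "\<dots> \<le> \<bar>?x - ?y\<bar> * (real (B n) * real (B n))"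
    using le gauss_map_irr01[OF irr(2)] by (intro mult_left_mono mult_mono) (auto simp: irr01_def)
  also have "\<dots> \<le> (\<bar>x - y\<bar> * (real (\<Prod>i<n. B i))\<^sup>2) * (real (B n) * real (B n))"
    using Suc by (intro mult_right_mono) auto
  finally show ?case by (simp add: power2_eq_square mult_ac)
qed simp

text \<open>Different digits alone do not separate points, as the tails could nearly compensate. In
  \<open>J_set\<close> the next digit is at least 2, so both tails are at most \<open>1 / 2\<close>
  and the sums of digit and tail differ by at least \<open>1 / 2\<close>.\<close>

lemma J_set_separated:
  assumes xy: "x \<in> J_set" "y \<in> J_set"
    and eq: "\<And>i. i < n \<Longrightarrow> cf_a (Suc i) x = cf_a (Suc i) y"
    and neq: "cf_a (Suc n) x \<noteq> cf_a (Suc n) y"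
    and B: "\<And>i. i \<le> n \<Longrightarrow> cf_a (Suc i) x < B i" "cf_a (Suc n) y < B n"
  shows "1 \<le> 2 * \<bar>x - y\<bar> * (real (\<Prod>i<Suc n. B i))\<^sup>2"
proof -
  let ?x = "(gauss_map ^^ n) x" and ?y = "(gauss_map ^^ n) y"
  have xy': "x \<in> irr01" "y \<in> irr01" using xy by (auto simp: J_set_alt)
  have irr: "?x \<in> irr01" "?y \<in> irr01" using xy' by (auto intro: gauss_map_funpow_irr01)
  have half: "0 < gauss_map ((gauss_map ^^ n) w) \<and> gauss_map ((gauss_map ^^ n) w) \<le> 1 / 2" if w: "w \<in> J_set" for w
  proof -
    let ?t = "(gauss_map ^^ Suc n) w"
    have t: "?t \<in> irr01" using w by (intro gauss_map_funpow_irr01) (simp add: J_set_alt)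
    have "2 \<le> cf_a (Suc 0) ?t"
      using J_set_digit_ge[OF w, of "Suc (Suc n)"] cf_a_shift[of "Suc 0" "Suc n" w] by simp
    then have "2 \<le> real (cf_a (Suc 0) ?t) + gauss_map ?t"
      using gauss_map_irr01[OF t] by (simp add: irr01_def)
    then have "1 / (real (cf_a (Suc 0) ?t) + gauss_map ?t) \<le> 1 / 2" by (intro divide_left_mono) auto
    then show ?thesis using cf_expand[OF t] t by (simp add: irr01_def)
  qed
  have dig: "cf_a (Suc 0) ?x = cf_a (Suc n) x" "cf_a (Suc 0) ?y = cf_a (Suc n) y"
    using cf_a_shift[of "Suc 0" n] by auto
  have "1 / 2 \<le> \<bar>real (cf_a (Suc n) x) + gauss_map ?x - (real (cf_a (Suc n) y) + gauss_map ?y)\<bar>"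
  proof -
    have "\<bar>real (cf_a (Suc n) x) - real (cf_a (Suc n) y)\<bar> \<ge> 1" using neq by linarith
    then show ?thesis using half[OF xy(1)] half[OF xy(2)] by linarith
  qed
  also have "\<dots> = \<bar>?x - ?y\<bar> *
      ((real (cf_a (Suc n) x) + gauss_map ?x) * (real (cf_a (Suc n) y) + gauss_map ?y))"
    using gauss_map_dist[OF irr] dig by simp
  also have "\<dots> \<le> \<bar>?x - ?y\<bar> * (real (B n) * real (B n))"
    using half[OF xy(1)] half[OF xy(2)] B(1)[of n] B(2) by (intro mult_left_mono mult_mono) auto
  also have "\<dots> \<le> (\<bar>x - y\<bar> * (real (\<Prod>i<n. B i))\<^sup>2) * (real (B n) * real (B n))"
    by (intro mult_right_mono cf_prefix_dist xy' eq B(1)) auto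
  finally show ?thesis by (simp add: power2_eq_square mult_ac)
qed

text \<open>The points \<open>g z\<close> have digits \<open>A i\<close> plus the mixed radix digits
  of \<open>z\<close>. If \<open>z\<close> and \<open>w\<close> first differ at \<open>n\<close>,
  their distance is at most the inverse product of \<open>m i\<close> over \<open>i < n\<close>,
  whereas the separation of the images also involves the differing digit \<open>n\<close>. This
  explains the two ranges in \<open>bound\<close>, which yields the Hoelder estimate.\<close>

lemma hausdorff_measure_cf_cantor:
  assumes s: "s > 0" and C: "C > 0" and A: "A 0 \<ge> 1" and m: "\<And>i. m i \<ge> 1"
    and Am: "\<And>i. A i + m i \<le> A (Suc i)"
    and E: "{x \<in> J_set. \<forall>i. A i \<le> cf_a (Suc i) x \<and> cf_a (Suc i) x < A i + m i} \<subseteq> E"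
    and bound: "\<And>n. real (\<Prod>i<Suc n. A i + m i) powr (2 * s) \<le> C * real (\<Prod>i<n. m i)"
  shows "hausdorff_measure s E \<noteq> 0"
proof -
  have A1: "A i \<ge> 1" for i
  proof (induction i)
    case (Suc i)
    then show ?case using Am[of i] by linarith
  qed (rule A)
  have "\<exists>x\<in>irr01. \<forall>i. cf_a (Suc i) x = A i + mr_digit m z i" for z
    using A1 by (intro cf_exists) (simp add: trans_le_add1)
  then obtain g where g: "\<And>z. g z \<in> irr01" "\<And>z i. cf_a (Suc i) (g z) = A i + mr_digit m z i"
    by metis
  have J: "g z \<in> J_set" if z: "z \<in> {0..<1}" for z
  proof -
    have "cf_a (Suc i) (g z) < cf_a (Suc (Suc i)) (g z)" for i
      using mr_digit_less[of z m i, OF z m] Am[of i] by (simp add: g)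
    then have "\<forall>n\<ge>1. cf_a n (g z) < cf_a (Suc n) (g z)" by (metis One_nat_def Suc_le_D)
    then show ?thesis using g(1) by (simp add: J_set_alt)
  qed
  have B: "cf_a (Suc i) (g z) < A i + m i" if "z \<in> {0..<1}" for z i
    using mr_digit_less[of z m i, OF that m] by (simp add: g)
  define Q where "Q n = real (\<Prod>i<Suc n. A i + m i)" for n
  have B2: "A i + m i \<ge> 2" for i using A1[of i] m[of i] by linarith
  have Q: "Q n \<ge> 2 ^ n" for n
  proof -
    have "(\<Prod>i<Suc n. 2) \<le> (\<Prod>i<Suc n. A i + m i)" by (intro prod_mono) (use B2 in auto)
    then have "real (2 ^ Suc n) \<le> Q n" unfolding Q_def by (simp del: prod.lessThan_Suc only: of_nat_le_iff prod_constant card_lessThan)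
    moreover have "(2::real) ^ n \<le> real (2 ^ Suc n)" by simp
    ultimately show ?thesis by (rule order_trans[rotated])
  qed
  have M: "\<bar>z - w\<bar> \<le> C * Q n powr (- 2 * s)"
    if zw: "z \<in> {0..<1}" "w \<in> {0..<1}" "\<And>i. i < n \<Longrightarrow> mr_digit m z i = mr_digit m w i" for z w n
  proof -
    have Qpos: "Q n > 0" using Q[of n] by (smt (verit) zero_less_power)
    have "\<bar>z - w\<bar> * Q n powr (2 * s) \<le> \<bar>z - w\<bar> * (C * real (\<Prod>i<n. m i))"
      unfolding Q_def by (intro mult_left_mono bound) auto
    also have "\<dots> = C * (\<bar>z - w\<bar> * real (\<Prod>i<n. m i))" by (simp only: mult_ac)
    also have "\<dots> \<le> C * 1" using C mr_digit_eq_dist[OF zw] by (intro mult_left_mono) auto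
    finally show ?thesis using Qpos by (simp add: powr_minus field_simps)
  qed
  show ?thesis
  proof (rule hausdorff_measure_ne_0[OF s])
    \<comment> \<open>The factor \<open>2 powr s\<close> absorbs the 2 in
      \<open>J_set_separated\<close>.\<close>
    show "C * 2 powr s > 0" using C by simp
    show "g z \<in> E" if "z \<in> {0..<1}" for z
      using J[OF that] B[OF that] by (intro subsetD[OF E]) (auto simp: g)
    show "\<bar>z - w\<bar> \<le> C * 2 powr s * \<bar>g z - g w\<bar> powr s" if zw: "z \<in> {0..<1}" "w \<in> {0..<1}" for z w
    proof (cases "\<forall>i. mr_digit m z i = mr_digit m w i")
      case True
      \<comment> \<open>With all digits equal the estimate \<open>M\<close> holds for every
        \<open>n\<close>; as \<open>Q n \<ge> 2 ^ n\<close>, it forces \<open>z = w\<close>.\<close>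
      have "\<bar>z - w\<bar> \<le> C * (2 powr (- 2 * s)) ^ n" for n
      proof -
        have "\<bar>z - w\<bar> \<le> C * Q n powr (- 2 * s)" using True zw by (intro M) auto
        also have "\<dots> \<le> C * (2 ^ n) powr (- 2 * s)"
          using C s Q[of n] by (intro mult_left_mono powr_mono2') auto
        also have "(2 ^ n :: real) powr (- 2 * s) = (2 powr (- 2 * s)) ^ n"
          by (simp add: powr_powr mult_ac flip: powr_realpow)
        finally show ?thesis .
      qed
      moreover have "(\<lambda>n. C * (2 powr (- 2 * s)) ^ n) \<longlonglongrightarrow> C * 0"
        using s powr_less_mono[of "- 2 * s" 0 2] by (intro tendsto_mult_left LIMSEQ_realpow_zero) auto
      ultimately have "\<bar>z - w\<bar> \<le> C * 0" by (intro LIMSEQ_le_const) auto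
      then show ?thesis using C by simp
    next
      case False
      define n where "n = (LEAST i. mr_digit m z i \<noteq> mr_digit m w i)"
      have n: "mr_digit m z n \<noteq> mr_digit m w n" "\<And>i. i < n \<Longrightarrow> mr_digit m z i = mr_digit m w i"
        using False LeastI_ex[of "\<lambda>i. mr_digit m z i \<noteq> mr_digit m w i"] not_less_Least
        unfolding n_def by blast+
      have "1 \<le> 2 * \<bar>g z - g w\<bar> * (Q n)\<^sup>2"
        unfolding Q_def using n zw B by (intro J_set_separated J) (auto simp: g)
      moreover have Qpos: "Q n > 0" using Q[of n] by (smt (verit) zero_less_power)
      ultimately have sep: "1 / (Q n)\<^sup>2 \<le> 2 * \<bar>g z - g w\<bar>" by (simp add: field_simps)
      have "\<bar>z - w\<bar> \<le> C * Q n powr (- 2 * s)" using zw n by (intro M) auto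
      also have "Q n powr (- 2 * s) = (1 / (Q n)\<^sup>2) powr s"
        using Qpos by (simp add: powr_divide powr_minus_divide powr_powr flip: powr_numeral)
      also have "\<dots> \<le> (2 * \<bar>g z - g w\<bar>) powr s" using s sep by (intro powr_mono2) auto
      also have "\<dots> = 2 powr s * \<bar>g z - g w\<bar> powr s" by (simp add: powr_mult)
      finally show ?thesis using C by (simp add: mult.assoc)
    qed
  qed
qed

section \<open>The lower bound\<close>

lemma sigma_ge:
  fixes \<sigma> :: "nat \<Rightarrow> nat"
  assumes pos: "\<forall>n\<ge>1. 0 < \<sigma> n" and incr: "\<forall>n\<ge>1. \<sigma> n < \<sigma> (Suc n)" and "n \<ge> 1"
  shows "n \<le> \<sigma> n"
  using assms(3)
proof (induction n rule: dec_induct)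
  case base
  then show ?case using pos by (simp add: Suc_le_eq)
next
  case (step n)
  then have "\<sigma> n < \<sigma> (Suc n)" using incr by simp
  then show ?case using step by linarith
qed

section \<open>Density of the positions inside progressions\<close>

definition in_block :: "(nat \<Rightarrow> nat) \<Rightarrow> nat \<Rightarrow> bool" where
  "in_block \<sigma> i \<longleftrightarrow> (\<exists>n\<ge>1. \<sigma> n \<le> i \<and> i < \<sigma> n + n)"

text \<open>Summing \<open>K\<close> over \<open>j\<close> from \<open>K\<close> to
  \<open>k - 1\<close> telescopes on the right and gives \<open>k * (k - 1) / 2\<close> on the left
  up to the terms \<open>j < K\<close>, which \<open>K ^ 2\<close> absorbs.\<close>

lemma gap_sum_le:
  fixes \<sigma> :: "nat \<Rightarrow> nat"
  assumes \<theta>: "\<theta> > 0" and K: "\<And>j. j \<ge> K \<Longrightarrow> real j \<le> \<theta> * (real (\<sigma> (Suc j)) - real (\<sigma> j))"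
  shows "real k * (real k - 1) / 2 - (real K)\<^sup>2 \<le> \<theta> * real (\<sigma> k)"
proof (cases "k \<le> K")
  case True
  have "real k * (real k - 1) / 2 \<le> real k * real k" by (simp add: field_simps)
  also have "\<dots> \<le> real K * real K" using True by (intro mult_mono) auto
  finally have "real k * (real k - 1) / 2 - (real K)\<^sup>2 \<le> 0" by (simp add: power2_eq_square)
  also have "0 \<le> \<theta> * real (\<sigma> k)" using \<theta> by simp
  finally show ?thesis .
next
  case False
  then have "K \<le> k" by simp
  then show ?thesis
  proof (induction k rule: dec_induct)
    case base
    have "real K * (real K - 1) / 2 - (real K)\<^sup>2 \<le> 0"
      by (simp add: power2_eq_square field_simps) (rule order_trans[of _ 0], auto)
    also have "0 \<le> \<theta> * real (\<sigma> K)" using \<theta> by simp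
    finally show ?case .
  next
    case (step k)
    then show ?case using K[of k] by (simp add: field_simps)
  qed
qed

text \<open>If progression \<open>k\<close> is the last to start by \<open>n\<close>, the count is
  at most \<open>1 + ... + k = k * (k - 1) / 2 + k\<close>. The first part is bounded by
  \<open>gap_sum_le\<close>, and \<open>k\<close> is only of order \<open>sqrt n\<close>; so these
  positions have asymptotic density at most \<theta>.\<close>

lemma block_count_le:
  fixes \<sigma> :: "nat \<Rightarrow> nat"
  assumes pos: "\<forall>n\<ge>1. 0 < \<sigma> n" and incr: "\<forall>n\<ge>1. \<sigma> n < \<sigma> (Suc n)"
    and gap: "\<forall>n\<ge>1. \<sigma> (Suc n) \<ge> \<sigma> n + n" and \<theta>: "\<theta> > 0"
    and K: "\<And>j. j \<ge> K \<Longrightarrow> real j \<le> \<theta> * (real (\<sigma> (Suc j)) - real (\<sigma> j))"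
  shows "real (card {i \<in> {1..n}. in_block \<sigma> i}) \<le> \<theta> * real n + ((real K)\<^sup>2 + 2) + sqrt (2 * real n + 2)"
proof -
  define S where "S = {j \<in> {1..n}. \<sigma> j \<le> n}"
  have sub: "{i \<in> {1..n}. in_block \<sigma> i} \<subseteq> (\<Union>j\<in>S. {\<sigma> j..<\<sigma> j + j})"
  proof
    fix i assume "i \<in> {i \<in> {1..n}. in_block \<sigma> i}"
    then obtain j where j: "j \<ge> 1" "\<sigma> j \<le> i" "i < \<sigma> j + j" "i \<le> n" by (auto simp: in_block_def)
    then have "j \<in> S" using sigma_ge[OF pos incr, of j] by (auto simp: S_def)
    then show "i \<in> (\<Union>j\<in>S. {\<sigma> j..<\<sigma> j + j})" using j by auto
  qed
  have finS: "finite S" by (simp add: S_def)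
  have "card {i \<in> {1..n}. in_block \<sigma> i} \<le> card (\<Union>j\<in>S. {\<sigma> j..<\<sigma> j + j})"
    using sub finS by (intro card_mono) auto
  also have "\<dots> \<le> (\<Sum>j\<in>S. card {\<sigma> j..<\<sigma> j + j})" by (rule card_UN_le[OF finS])
  also have "\<dots> = (\<Sum>j\<in>S. j)" by simp
  finally have card: "card {i \<in> {1..n}. in_block \<sigma> i} \<le> (\<Sum>j\<in>S. j)" .
  show ?thesis
  proof (cases "S = {}")
    case True
    then have "real (card {i \<in> {1..n}. in_block \<sigma> i}) = 0" using card by simp
    moreover have "0 \<le> \<theta> * real n + ((real K)\<^sup>2 + 2) + sqrt (2 * real n + 2)"
      using \<theta> by (intro add_nonneg_nonneg) auto
    ultimately show ?thesis by linarith
  next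
    case False
    define k where "k = Max S"
    have k: "k \<in> S" "S \<subseteq> {1..k}"
      using finS False Max_in[OF finS False] Max_ge[OF finS] by (auto simp: k_def S_def)
    have "(\<Sum>j\<in>S. j) \<le> (\<Sum>j\<in>{1..k}. j)" using k by (intro sum_mono2) auto
    also have "(\<Sum>j\<in>{1..k}. j) = k * (k + 1) div 2"
      using gauss_sum_from_Suc_0[of k, where 'a = nat] by simp
    finally have "real (\<Sum>j\<in>S. j) \<le> real (k * (k + 1) div 2)" by (simp only: of_nat_le_iff)
    also have "\<dots> \<le> real (k * (k + 1)) / real 2" by (rule of_nat_div_le_of_nat)
    also have "\<dots> = real k * (real k + 1) / 2" by (simp add: algebra_simps)
    finally have "real (\<Sum>j\<in>S. j) \<le> real k * (real k + 1) / 2" .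
    then have D: "real (card {i \<in> {1..n}. in_block \<sigma> i}) \<le> real k * (real k - 1) / 2 + real k"
      using of_nat_mono[OF card, where 'a = real] by (simp add: field_simps)
    have \<sigma>k: "real (\<sigma> k) \<le> real n" using k by (simp add: S_def)
    have "real k * (real k - 1) / 2 - (real K)\<^sup>2 \<le> \<theta> * real (\<sigma> k)" by (rule gap_sum_le[OF \<theta> K])
    also have "\<dots> \<le> \<theta> * real n" using \<theta> \<sigma>k by simp
    finally have 1: "real k * (real k - 1) / 2 \<le> \<theta> * real n + (real K)\<^sup>2" by simp
    \<comment> \<open>A second use of \<open>gap_sum_le\<close>, with slope 1 taken from
      \<open>gap\<close>, shows that \<open>k\<close> is of order \<open>sqrt n\<close>.\<close>
    have "real k * (real k - 1) / 2 - (real 1)\<^sup>2 \<le> 1 * real (\<sigma> k)"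
    proof (rule gap_sum_le)
      fix j :: nat assume "j \<ge> 1"
      then have "\<sigma> j + j \<le> \<sigma> (Suc j)" using gap by simp
      then have "real (\<sigma> j + j) \<le> real (\<sigma> (Suc j))" by (simp only: of_nat_le_iff)
      then show "real j \<le> 1 * (real (\<sigma> (Suc j)) - real (\<sigma> j))" by simp
    qed simp
    then have "real k * (real k - 1) \<le> 2 * real n + 2" using \<sigma>k by simp
    moreover have "(real k - 1)\<^sup>2 \<le> real k * (real k - 1)"
      using k by (auto simp: S_def power2_eq_square intro!: mult_right_mono)
    ultimately have "(real k - 1)\<^sup>2 \<le> 2 * real n + 2" by linarith
    then have "real k - 1 \<le> sqrt (2 * real n + 2)" by (rule real_le_rsqrt)
    then show ?thesis using D 1 by linarith
  qed
qed

text \<open>Free digits at position \<open>i\<close> range over \<open>i ^ (L - 1)\<close> values from \<open>i ^ L\<close> on; digits inside a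
  block are forced to be consecutive integers.\<close>
fun digit_base :: "nat \<Rightarrow> (nat \<Rightarrow> nat) \<Rightarrow> nat \<Rightarrow> nat" where
  "digit_base L \<sigma> 0 = 0"
| "digit_base L \<sigma> (Suc i) =
    (if \<exists>n\<ge>1. \<sigma> n < Suc i \<and> Suc i < \<sigma> n + n then digit_base L \<sigma> i + 1 else Suc i ^ L)"

text \<open>For disjoint blocks, the first position \<open>i\<close> of a block also gets a single
  value, but at base \<open>i ^ L\<close>: the strict \<open>\<sigma> n < Suc i\<close> in
  \<open>digit_base\<close> lets only later positions continue from their predecessor.\<close>

definition digit_range :: "nat \<Rightarrow> (nat \<Rightarrow> nat) \<Rightarrow> nat \<Rightarrow> nat" where
  "digit_range L \<sigma> i = (if in_block \<sigma> i then 1 else i ^ (L - 1))"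

text \<open>Holds by \<open>(i + 1) ^ L \<ge> (i + 1) * i ^ (L - 1)\<close>. It makes room for the
  whole window at \<open>i\<close> below the next free window.\<close>

lemma Suc_power_ge:
  assumes "L \<ge> 1" shows "(i::nat) ^ L + i ^ (L - 1) \<le> Suc i ^ L"
proof -
  obtain l where "L = Suc l" using assms by (cases L) auto
  then show ?thesis using mult_le_mono2[OF power_mono[of i "Suc i" l], of "Suc i"] by (simp add: algebra_simps)
qed

lemma digit_base_le:
  assumes "L \<ge> 1" shows "digit_base L \<sigma> i \<le> i ^ L"
proof (induction i)
  case (Suc i)
  have "i ^ L + 1 \<le> Suc i ^ L"
    using power_strict_mono[of i "Suc i" L] assms by (simp add: Suc_le_eq)
  then show ?case using Suc by simp
qed simp

lemma digit_range_ge: "i \<ge> 1 \<Longrightarrow> digit_range L \<sigma> i \<ge> 1"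
  by (simp add: digit_range_def)

lemma digit_base_plus_range:
  assumes L: "L \<ge> 1" and i: "i \<ge> 1"
  shows "digit_base L \<sigma> i + digit_range L \<sigma> i \<le> Suc i ^ L"
proof -
  have "digit_range L \<sigma> i \<le> i ^ (L - 1)" using i by (simp add: digit_range_def)
  then show ?thesis using digit_base_le[OF L, of \<sigma> i] Suc_power_ge[OF L, of i] by linarith
qed

lemma digit_base_step:
  assumes L: "L \<ge> 1" and i: "i \<ge> 1"
  shows "digit_base L \<sigma> i + digit_range L \<sigma> i \<le> digit_base L \<sigma> (Suc i)"
proof (cases "\<exists>n\<ge>1. \<sigma> n < Suc i \<and> Suc i < \<sigma> n + n")
  case True
  \<comment> \<open>If \<open>Suc i\<close> continues a block then \<open>i\<close> belongs to it,
    so the window at \<open>i\<close> is a single value and the base grows by exactly 1.\<close>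
  then have "in_block \<sigma> i" unfolding in_block_def by (auto simp: less_Suc_eq_le intro: Suc_lessD)
  then show ?thesis using True by (simp add: digit_range_def)
next
  case False
  then have "digit_base L \<sigma> (Suc i) = Suc i ^ L" by (simp only: digit_base.simps if_False)
  then show ?thesis using digit_base_plus_range[OF L i, of \<sigma>] by simp
qed

text \<open>Inside a block every window is one integer and these integers are consecutive, so all
  progressions have difference 1.\<close>

lemma digit_window_subset_G_set:
  assumes pos: "\<forall>n\<ge>1. 0 < \<sigma> n"
  shows "{x \<in> J_set. \<forall>i. digit_base L \<sigma> (Suc i) \<le> cf_a (Suc i) x \<and>
     cf_a (Suc i) x < digit_base L \<sigma> (Suc i) + digit_range L \<sigma> (Suc i)} \<subseteq> G_set \<sigma>"
proof
  fix x assume x: "x \<in> {x \<in> J_set. \<forall>i. digit_base L \<sigma> (Suc i) \<le> cf_a (Suc i) x \<and>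
     cf_a (Suc i) x < digit_base L \<sigma> (Suc i) + digit_range L \<sigma> (Suc i)}"
  have block: "cf_a i x = digit_base L \<sigma> i" if "i \<ge> 1" "in_block \<sigma> i" for i
  proof -
    obtain j where j: "i = Suc j" using \<open>i \<ge> 1\<close> by (cases i) auto
    have "digit_base L \<sigma> (Suc j) \<le> cf_a (Suc j) x"
        "cf_a (Suc j) x < digit_base L \<sigma> (Suc j) + digit_range L \<sigma> (Suc j)"
      using x by blast+
    then show ?thesis using that(2) unfolding j digit_range_def by (simp del: digit_base.simps)
  qed
  have "cf_block_AP x (\<sigma> n) n" if n: "n \<ge> 1" for n
  proof -
    have "cf_a (\<sigma> n + Suc i) x = cf_a (\<sigma> n + i) x + 1" if i: "Suc i < n" for i
    proof -
      have "\<sigma> n \<ge> 1" using pos n by (simp add: Suc_le_eq)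
      moreover have "in_block \<sigma> (\<sigma> n + i)" "in_block \<sigma> (\<sigma> n + Suc i)"
        unfolding in_block_def using i n by (auto intro!: exI[of _ n])
      ultimately have "cf_a (\<sigma> n + Suc i) x = digit_base L \<sigma> (\<sigma> n + Suc i)"
          "cf_a (\<sigma> n + i) x = digit_base L \<sigma> (\<sigma> n + i)"
        using block[of "\<sigma> n + Suc i"] block[of "\<sigma> n + i"] by simp_all
      moreover have "\<exists>k\<ge>1. \<sigma> k < Suc (\<sigma> n + i) \<and> Suc (\<sigma> n + i) < \<sigma> k + k"
        using i n by (intro exI[of _ n]) auto
      then have "digit_base L \<sigma> (\<sigma> n + Suc i) = digit_base L \<sigma> (\<sigma> n + i) + 1"
        by (simp only: add_Suc_right digit_base.simps if_True)
      ultimately show ?thesis by simp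
    qed
    then have step: "int (cf_a (\<sigma> n + i + 1) x) - int (cf_a (\<sigma> n + i) x) = 1" if "i + 1 < n" for i
      using that by simp
    show ?thesis unfolding cf_block_AP_def
    proof (intro allI impI)
      fix i assume i: "i + 1 < n"
      then show "int (cf_a (\<sigma> n + i + 1) x) - int (cf_a (\<sigma> n + i) x) = int (cf_a (\<sigma> n + 1) x) - int (cf_a (\<sigma> n) x)"
        using step[OF i] step[of 0] by simp
    qed
  qed
  then show "x \<in> G_set \<sigma>" using x unfolding G_set_def by auto
qed

text \<open>Lower Stirling bound; the induction step rests on
  \<open>n * ln (1 + 1 / n) \<le> 1\<close>.\<close>

lemma ln_fact_ge: "n \<ge> 1 \<Longrightarrow> real n * ln (real n) - real n \<le> ln (fact n)"
proof (induction n rule: dec_induct)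
  case (step n)
  have "ln (1 + 1 / real n) \<le> 1 / real n" by (rule ln_add_one_self_le_self) simp
  moreover have "1 + 1 / real n = real (Suc n) / real n" using step by (simp add: field_simps)
  ultimately have "ln (real (Suc n)) - ln (real n) \<le> 1 / real n" using step by (simp add: ln_div)
  then have "real n * (ln (real (Suc n)) - ln (real n)) \<le> real n * (1 / real n)"
    by (rule mult_left_mono) simp
  then have "real n * ln (real (Suc n)) - real n * ln (real n) \<le> 1" using step by (simp add: algebra_simps)
  moreover have "ln (fact (Suc n) :: real) = ln (real (Suc n)) + ln (fact n)"
    using step by (simp add: ln_mult del: of_nat_Suc)
  ultimately show ?case using step by (simp add: algebra_simps)
qed simp

text \<open>Forced positions have density at most \<theta>, so \<open>ln (M n)\<close> is
  asymptotically at least \<open>(L - 1) * (1 - \<theta>) * n * ln n\<close>, while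
  \<open>ln (Q n)\<close> is at most about \<open>L * n * ln n\<close>. For large \<open>L\<close>
  the ratio exceeds \<open>2 * s\<close>.\<close>

lemma hausdorff_measure_G_set_ne_0:
  fixes \<sigma> :: "nat \<Rightarrow> nat"
  assumes pos: "\<forall>n\<ge>1. 0 < \<sigma> n" and incr: "\<forall>n\<ge>1. \<sigma> n < \<sigma> (Suc n)"
    and gap: "\<forall>n\<ge>1. \<sigma> (Suc n) \<ge> \<sigma> n + n" and \<theta>: "\<theta> > 0" and s: "s > 0" "2 * s < 1 - \<theta>"
    and ev: "eventually (\<lambda>j. real j \<le> \<theta> * (real (\<sigma> (Suc j)) - real (\<sigma> j))) sequentially"
  shows "hausdorff_measure s (G_set \<sigma>) \<noteq> 0"
proof -
  obtain K where K: "\<And>j. j \<ge> K \<Longrightarrow> real j \<le> \<theta> * (real (\<sigma> (Suc j)) - real (\<sigma> j))"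
    using ev unfolding eventually_sequentially by blast
  define c where "c = (real K)\<^sup>2 + 2"
  \<comment> \<open>Rearranged, this is the comparison of leading coefficients
    \<open>2 * s * L < (L - 1) * (1 - \<theta>)\<close>.\<close>
  obtain L where L: "real L * (1 - \<theta> - 2 * s) > 1 - \<theta>"
    using reals_Archimedean3[of "1 - \<theta> - 2 * s"] s by auto
  have "L \<noteq> 0" using L s by (cases "L = 0") auto
  then have L1: "L \<ge> 1" by simp
  have L2: "2 * s * real L < (real L - 1) * (1 - \<theta>)" using L by (simp add: algebra_simps)
  \<comment> \<open>Index \<open>i\<close> stands for the digit at position
    \<open>Suc i\<close>.\<close>
  define A where "A i = digit_base L \<sigma> (Suc i)" for i
  define m where "m i = digit_range L \<sigma> (Suc i)" for i
  define Q where "Q n = real (\<Prod>i<Suc n. A i + m i)" for n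
  define M where "M n = real (\<Prod>i<n. m i)" for n
  have m1: "m i \<ge> 1" for i using digit_range_ge[of "Suc i" L \<sigma>] by (simp add: m_def)
  have A0: "A 0 \<ge> 1" using pos by (auto simp: A_def)
  have M1: "M n \<ge> 1" for n
  proof -
    have "(\<Prod>i<n. 1) \<le> (\<Prod>i<n. m i)" by (intro prod_mono) (use m1 in auto)
    then have "1 \<le> (\<Prod>i<n. m i)" by simp
    then have "real 1 \<le> real (\<Prod>i<n. m i)" by (simp only: of_nat_le_iff)
    then show ?thesis unfolding M_def by simp
  qed
  have Qpos: "Q n > 0" for n
    unfolding Q_def of_nat_prod using m1 by (intro prod_pos) (simp add: Suc_le_eq add_nonneg_pos)
  have lnQ: "ln (Q n) \<le> real L * (real n + 1) * ln (real n + 2)" for n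
  proof -
    have "(\<Prod>i<Suc n. A i + m i) \<le> (\<Prod>i<Suc n. (n + 2) ^ L)"
    proof (intro prod_mono conjI)
      fix i assume "i \<in> {..<Suc n}"
      then have "Suc (Suc i) ^ L \<le> (n + 2) ^ L" by (intro power_mono) auto
      then show "A i + m i \<le> (n + 2) ^ L"
        using digit_base_plus_range[OF L1, of "Suc i" \<sigma>] by (simp add: A_def m_def)
    qed simp
    also have "\<dots> = (n + 2) ^ (L * (n + 1))"
      by (simp only: prod_constant card_lessThan Suc_eq_plus1 power_mult)
    finally have "Q n \<le> real ((n + 2) ^ (L * (n + 1)))" unfolding Q_def by (simp only: of_nat_le_iff)
    then have "ln (Q n) \<le> ln (real ((n + 2) ^ (L * (n + 1))))" using Qpos by (intro ln_mono) auto
    also have "\<dots> = real (L * (n + 1)) * ln (real (n + 2))"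
      by (simp add: ln_realpow del: of_nat_add of_nat_mult)
    finally show ?thesis by (simp add: algebra_simps)
  qed
  have lnM: "(real L - 1) * (real n * ln (real n) - real n - (\<theta> * real n + c + sqrt (2 * real n + 2)) * ln (real n)) \<le> ln (M n)"
    if n: "n \<ge> 1" for n
  proof -
    define D where "D = card {i \<in> {1..n}. in_block \<sigma> i}"
    \<comment> \<open>If every position were free, the product of the ranges would be
      \<open>fact n ^ (L - 1)\<close>. Each of the \<open>D\<close> forced positions loses at most a
      factor \<open>n ^ (L - 1)\<close>.\<close>
    have "fact n ^ (L - 1) = (\<Prod>i\<in>{1..n}. i ^ (L - 1))" by (simp add: fact_prod prod_power_distrib)
    also have "\<dots> \<le> (\<Prod>i\<in>{1..n}. digit_range L \<sigma> i * (if in_block \<sigma> i then n ^ (L - 1) else 1))"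
      by (intro prod_mono) (auto simp: digit_range_def power_mono)
    also have "\<dots> = (\<Prod>i\<in>{1..n}. digit_range L \<sigma> i) * (n ^ (L - 1)) ^ D"
      by (simp add: prod.distrib D_def prod.If_cases Int_def)
    also have "(\<Prod>i\<in>{1..n}. digit_range L \<sigma> i) = (\<Prod>i<n. m i)"
      unfolding m_def by (simp add: prod.atLeast1_atMost_eq)
    finally have "real (fact n ^ (L - 1)) \<le> real ((\<Prod>i<n. m i) * (n ^ (L - 1)) ^ D)"
      by (simp only: of_nat_le_iff)
    then have "(fact n :: real) ^ (L - 1) \<le> M n * (real n ^ (L - 1)) ^ D" by (simp add: M_def)
    then have "ln ((fact n :: real) ^ (L - 1)) \<le> ln (M n * (real n ^ (L - 1)) ^ D)"
      by (intro ln_mono) auto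
    also have "\<dots> = ln (M n) + real D * (real (L - 1) * ln (real n))"
      using n M1[of n] by (simp add: ln_mult ln_realpow)
    also have "ln ((fact n :: real) ^ (L - 1)) = real (L - 1) * ln (fact n)" by (simp add: ln_realpow)
    finally have 1: "(real L - 1) * (ln (fact n) - real D * ln (real n)) \<le> ln (M n)"
      using L1 by (simp add: of_nat_diff algebra_simps)
    have "real D \<le> \<theta> * real n + c + sqrt (2 * real n + 2)"
      unfolding D_def c_def by (rule block_count_le[OF pos incr gap \<theta> K])
    then have "real D * ln (real n) \<le> (\<theta> * real n + c + sqrt (2 * real n + 2)) * ln (real n)"
      using n by (intro mult_right_mono) auto
    then have "(real L - 1) * (real n * ln (real n) - real n - (\<theta> * real n + c + sqrt (2 * real n + 2)) * ln (real n))
        \<le> (real L - 1) * (ln (fact n) - real D * ln (real n))"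
      using ln_fact_ge[OF n] L1 by (intro mult_left_mono) auto
    then show ?thesis using 1 by linarith
  qed
  \<comment> \<open>Divided by \<open>n * ln n\<close>, both estimates converge to their leading
    coefficients, which \<open>v\<close> separates.\<close>
  have lim1: "((\<lambda>n::nat. 2 * s * (real L * (real n + 1) * ln (real n + 2)) / (real n * ln (real n))) \<longlongrightarrow> 2 * s * real L) sequentially"
    by real_asymp
  have lim2: "((\<lambda>n::nat. (real L - 1) * (real n * ln (real n) - real n - (\<theta> * real n + c + sqrt (2 * real n + 2)) * ln (real n))
      / (real n * ln (real n))) \<longlongrightarrow> (real L - 1) * (1 - \<theta>)) sequentially"
    by real_asymp
  obtain v where v: "2 * s * real L < v" "v < (real L - 1) * (1 - \<theta>)" using dense[OF L2] by blast
  have "eventually (\<lambda>n. Q n powr (2 * s) \<le> M n) sequentially"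
    using order_tendstoD(2)[OF lim1 v(1)] order_tendstoD(1)[OF lim2 v(2)] eventually_ge_at_top[of 2]
  proof eventually_elim
    case (elim n)
    have p: "real n * ln (real n) > 0" using elim(3) by simp
    have "2 * s * (real L * (real n + 1) * ln (real n + 2)) < v * (real n * ln (real n))"
      using elim(1) p by (simp only: pos_divide_less_eq)
    moreover have "v * (real n * ln (real n)) < (real L - 1) * (real n * ln (real n) - real n - (\<theta> * real n + c + sqrt (2 * real n + 2)) * ln (real n))"
      using elim(2) p by (simp only: pos_less_divide_eq)
    moreover have "2 * s * ln (Q n) \<le> 2 * s * (real L * (real n + 1) * ln (real n + 2))"
      using s lnQ[of n] by (intro mult_left_mono) auto
    ultimately have "2 * s * ln (Q n) \<le> ln (M n)" using lnM[of n] elim(3) by linarith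
    then have "exp (2 * s * ln (Q n)) \<le> exp (ln (M n))" by simp
    then show ?case using Qpos[of n] M1[of n] by (simp add: powr_def)
  qed
  then obtain N where N: "\<And>n. n \<ge> N \<Longrightarrow> Q n powr (2 * s) \<le> M n" unfolding eventually_sequentially by blast
  \<comment> \<open>The finitely many \<open>n < N\<close> are absorbed in the constant; the summand
    1 ensures \<open>C \<ge> 1\<close> for the other \<open>n\<close>.\<close>
  define C where "C = 1 + (\<Sum>n<N. Q n powr (2 * s))"
  have C1: "C \<ge> 1" by (simp add: C_def sum_nonneg)
  have bound: "Q n powr (2 * s) \<le> C * M n" for n
  proof (cases "n < N")
    case True
    then have "Q n powr (2 * s) \<le> (\<Sum>n<N. Q n powr (2 * s))" by (intro member_le_sum) auto
    then have "Q n powr (2 * s) \<le> C * 1" by (simp add: C_def)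
    also have "\<dots> \<le> C * M n" using C1 M1[of n] by (intro mult_left_mono) auto
    finally show ?thesis .
  next
    case False
    then have "Q n powr (2 * s) \<le> 1 * M n" using N[of n] by simp
    also have "\<dots> \<le> C * M n" using C1 M1[of n] by (intro mult_right_mono) auto
    finally show ?thesis .
  qed
  show ?thesis
  proof (rule hausdorff_measure_cf_cantor[where A = A and m = m and C = C])
    show "A i + m i \<le> A (Suc i)" for i using digit_base_step[OF L1, of "Suc i" \<sigma>] by (simp only: A_def m_def)
    show "{x \<in> J_set. \<forall>i. A i \<le> cf_a (Suc i) x \<and> cf_a (Suc i) x < A i + m i} \<subseteq> G_set \<sigma>"
      unfolding A_def m_def by (rule digit_window_subset_G_set[OF pos])
    show "real (\<Prod>i<Suc n. A i + m i) powr (2 * s) \<le> C * real (\<Prod>i<n. m i)" for n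
      using bound[of n] by (simp only: Q_def M_def)
  qed (use s C1 A0 m1 in auto)
qed

section \<open>The dimension\<close>

lemma hausdorff_measure_empty: "s > 0 \<Longrightarrow> hausdorff_measure s {} = 0"
  using cov_content_le[of "{}" "\<lambda>_. {}" s] by (intro hausdorff_measure_null) auto

text \<open>With the convention \<open>0 ^ 0 = 1\<close> every nonempty set costs 1, so a cover of
  weight below 1 consists of empty sets.\<close>

lemma hausdorff_measure_0_eq_0_imp_empty:
  assumes "hausdorff_measure 0 E = 0" shows "E = {}"
proof -
  have "hausdorff_content 1 0 E \<le> hausdorff_measure 0 E"
    unfolding hausdorff_measure_def by (intro SUP_upper) simp
  then have "hausdorff_content 1 0 E < 1" using assms by simp
  then obtain U where U: "E \<subseteq> (\<Union>i::nat. U i)" "(\<Sum>i. ennreal (diam_pow 0 (U i))) < 1"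
    unfolding hausdorff_content_def INF_less_iff by auto
  have "U i = {}" for i
  proof (rule ccontr)
    assume "U i \<noteq> {}"
    then have "diam_pow 0 (U i) = 1" by (simp add: diam_pow_def)
    then show False using ennreal_suminf_lessD[OF U(2), of i] by simp
  qed
  then show ?thesis using U(1) by simp
qed

lemma hausdorff_dim_eqI:
  assumes d: "d \<ge> 0"
    and null: "\<And>s. s > d \<Longrightarrow> hausdorff_measure s E = 0"
    and pos: "\<And>s. 0 < s \<Longrightarrow> s < d \<Longrightarrow> hausdorff_measure s E \<noteq> 0"
  shows "hausdorff_dim E = d"
proof -
  define X where "X = {s. s \<ge> 0 \<and> hausdorff_measure s E = 0}"
  have bdd: "bdd_below X" by (auto simp: X_def intro: bdd_belowI[of _ 0])
  have mem: "s \<in> X" if "s > d" for s using null[OF that] that d by (simp add: X_def)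
  have "Inf X \<le> d" by (rule dense_ge) (intro cInf_lower mem bdd)
  moreover have "d \<le> Inf X"
  proof (rule cInf_greatest)
    show "X \<noteq> {}" using mem[of "d + 1"] by auto
    fix x assume x: "x \<in> X"
    show "d \<le> x"
    proof (rule ccontr)
      assume "\<not> d \<le> x"
      then have lt: "x < d" by simp
      show False
      proof (cases "x = 0")
        case True
        \<comment> \<open>Exponent 0 competes in the infimum, but only an empty \<open>E\<close> is
          null for it, and that would contradict \<open>pos\<close> at \<open>d / 2\<close>.\<close>
        then have "E = {}" using x hausdorff_measure_0_eq_0_imp_empty by (simp add: X_def)
        then show False using pos[of "d / 2"] lt True hausdorff_measure_empty[of "d / 2"] by simp
      next
        case False
        then show False using x pos[of x] lt by (simp add: X_def)
      qed
    qed
  qed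
  ultimately show ?thesis by (simp add: hausdorff_dim_def X_def)
qed

theorem theorem1p2:
  fixes \<sigma> :: "nat \<Rightarrow> nat" and \<beta> :: ereal
  assumes pos: "\<forall>n\<ge>1. 0 < \<sigma> n"
    and incr: "\<forall>n\<ge>1. \<sigma> n < \<sigma> (Suc n)"
    and gap: "\<forall>n\<ge>1. \<sigma> (Suc n) \<ge> \<sigma> n + n"
    and lim: "(\<lambda>n. ereal ((real (\<sigma> (Suc n)) - real (\<sigma> n)) / real n)) \<longlonglongrightarrow> \<beta>"
  shows "hausdorff_dim (G_set \<sigma>) =
           (if \<beta> = \<infinity> then 1 / 2 else (real_of_ereal \<beta> - 1) / (2 * real_of_ereal \<beta>))"
proof -
  define \<rho> where "\<rho> n = (real (\<sigma> (Suc n)) - real (\<sigma> n)) / real n" for n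
  have lim': "(\<lambda>n. ereal (\<rho> n)) \<longlonglongrightarrow> \<beta>" using lim by (simp add: \<rho>_def)
  have \<rho>n: "real (\<sigma> (Suc n)) - real (\<sigma> n) = \<rho> n * real n" if "n \<ge> 1" for n
    using that by (simp add: \<rho>_def)
  have \<rho>1: "\<rho> n \<ge> 1" if "n \<ge> 1" for n
  proof -
    have "\<sigma> n + n \<le> \<sigma> (Suc n)" using gap that by simp
    then have "real (\<sigma> n + n) \<le> real (\<sigma> (Suc n))" by (simp only: of_nat_le_iff)
    then show ?thesis using that by (simp add: \<rho>_def field_simps)
  qed
  have \<beta>1: "\<beta> \<ge> 1"
    by (rule LIMSEQ_le_const[OF lim']) (use \<rho>1 in \<open>auto intro!: exI[of _ 1] simp: one_ereal_def\<close>)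
  \<comment> \<open>\<theta> lies between \<open>1 / \<beta>\<close> and \<open>1 - 2 * s\<close>;
    since \<open>\<rho> j\<close> tends to \<beta>, it eventually exceeds
    \<open>1 / \<theta>\<close>.\<close>
  have lower: "hausdorff_measure s (G_set \<sigma>) \<noteq> 0"
    if s: "s > 0" and \<theta>: "\<theta> > 0" "2 * s < 1 - \<theta>" "ereal (1 / \<theta>) < \<beta>" for s \<theta>
  proof (rule hausdorff_measure_G_set_ne_0[OF pos incr gap \<theta>(1) s \<theta>(2)])
    show "\<forall>\<^sub>F j in sequentially. real j \<le> \<theta> * (real (\<sigma> (Suc j)) - real (\<sigma> j))"
      using order_tendstoD(1)[OF lim' \<theta>(3)] eventually_ge_at_top[of 1]
    proof eventually_elim
      case (elim j)
      then have "1 \<le> \<theta> * \<rho> j" using \<theta>(1) by (simp add: field_simps)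
      then have "1 * real j \<le> \<theta> * \<rho> j * real j" by (intro mult_right_mono) auto
      then show ?case using \<rho>n[of j] elim by (simp add: mult.assoc)
    qed
  qed
  show ?thesis
  proof (cases "\<beta> = \<infinity>")
    case True
    have "hausdorff_dim (G_set \<sigma>) = 1 / 2"
    proof (rule hausdorff_dim_eqI)
      fix s :: real assume s: "s > 1 / 2"
      show "hausdorff_measure s (G_set \<sigma>) = 0"
      proof (rule hausdorff_measure_G_set_null[OF gap pos])
        \<comment> \<open>With \<open>\<tau> = 2 * s > 1\<close> the inequality reduces to
          \<open>r \<le> n\<close>.\<close>
        show "\<forall>\<^sub>F n in sequentially. 2 * s * (real (\<sigma> (Suc n)) - real (\<sigma> n) - real n)
            \<le> 2 * s * (real (\<sigma> (Suc n)) - real (\<sigma> n) - real r)" for r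
          using eventually_ge_at_top[of r] by eventually_elim (use s in simp)
      qed (use s in auto)
    next
      fix s :: real assume "0 < s" "s < 1 / 2"
      then show "hausdorff_measure s (G_set \<sigma>) \<noteq> 0"
        using True by (intro lower[of s "(1 - 2 * s) / 2"]) (auto simp: field_simps)
    qed simp
    then show ?thesis using True by simp
  next
    case False
    then obtain b where b: "\<beta> = ereal b" using \<beta>1 by (cases \<beta>) auto
    have b1: "b \<ge> 1" using \<beta>1 by (simp add: b one_ereal_def)
    have \<rho>lim: "\<rho> \<longlonglongrightarrow> b" using lim' by (simp add: b)
    have "hausdorff_dim (G_set \<sigma>) = (b - 1) / (2 * b)"
    proof (rule hausdorff_dim_eqI)
      fix s assume s: "s > (b - 1) / (2 * b)"
      \<comment> \<open>Chosen so that \<open>e * (2 * b)\<close> is the slack in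
        \<open>2 * s * b > b - 1\<close>; since \<open>b - 1 < 2 * b\<close>, the exponent
        \<open>\<tau> = 1 + e\<close> keeps part of it.\<close>
      define e where "e = (2 * s * b - (b - 1)) / (2 * b)"
      have e: "e > 0" using s b1 by (simp add: e_def field_simps)
      have "(1 + e) * (b - 1) < 2 * s * b"
      proof -
        have "e * (b - 1) < e * (2 * b)" using e b1 by (intro mult_strict_left_mono) auto
        also have "\<dots> = 2 * s * b - (b - 1)" using b1 by (simp add: e_def)
        finally show ?thesis by (simp add: algebra_simps)
      qed
      then have L: "2 * s * (b - 0) - (1 + e) * (b - 1) > 0" by simp
      have s0: "s > 0" using s b1 by (smt (verit) divide_nonneg_pos)
      show "hausdorff_measure s (G_set \<sigma>) = 0"
      proof (rule hausdorff_measure_G_set_null[OF gap pos s0])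
        show "1 + e > 1" using e by simp
        fix r :: nat
        \<comment> \<open>Right side minus left side of the required inequality, divided by
          \<open>n\<close>; the limit is positive by \<open>L\<close>.\<close>
        have "(\<lambda>n. 2 * s * (\<rho> n - real r / real n) - (1 + e) * (\<rho> n - 1)) \<longlonglongrightarrow> 2 * s * (b - 0) - (1 + e) * (b - 1)"
          by (intro tendsto_intros \<rho>lim lim_const_over_n)
        from order_tendstoD(1)[OF this L] eventually_ge_at_top[of 1]
        show "\<forall>\<^sub>F n in sequentially. (1 + e) * (real (\<sigma> (Suc n)) - real (\<sigma> n) - real n)
            \<le> 2 * s * (real (\<sigma> (Suc n)) - real (\<sigma> n) - real r)"
        proof eventually_elim
          case (elim n)
          then have "0 \<le> (2 * s * (\<rho> n - real r / real n) - (1 + e) * (\<rho> n - 1)) * real n" by simp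
          also have "\<dots> = 2 * s * (\<rho> n * real n - real r) - (1 + e) * (\<rho> n * real n - real n)"
            using elim by (simp add: field_simps)
          finally show ?case using \<rho>n[of n] elim by simp
        qed
      qed
    next
      fix s assume s: "0 < s" "s < (b - 1) / (2 * b)"
      \<comment> \<open>The hypothesis on \<open>s\<close> is exactly the room needed to place
        \<theta>.\<close>
      then have "1 / b < 1 - 2 * s" using b1 by (simp add: field_simps)
      then obtain \<theta> where \<theta>: "1 / b < \<theta>" "\<theta> < 1 - 2 * s" using dense by blast
      have "\<theta> > 0" using \<theta>(1) b1 by (smt (verit) divide_pos_pos)
      then show "hausdorff_measure s (G_set \<sigma>) \<noteq> 0"
        using s \<theta> b1 by (intro lower[of s \<theta>]) (auto simp: b field_simps)
    qed (use b1 in simp)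
    then show ?thesis using b by simp
  qed
qed

end
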